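(* Let $p>3$ be a prime. Then $$\sum_{n=0}^{(p-1)/2}\frac{6n+1}{256^n}\binom{2n}n^3\equiv p(-1)^{(p-1)/2}+(-1)^{(p-1)/2}\frac{7}{24}p^4B_{p-3}\pmod{p^5}.$$
   Context: $B_0,B_1,\ldots$ are the Bernoulli numbers, defined by $\frac{x}{e^x-1}=\sum_{n\ge0}B_n\frac{x^n}{n!}$. For rational numbers $a,b$ whose denominators are coprime to $p$, $a\equiv b\pmod{p^m}$ means that $(a-b)/p^m$ is a rational number with denominator coprime to $p$. *)

theory Defs
  imports "HOL-Computational_Algebra.Computational_Algebra"
begin

definition bernoulli :: "nat \<Rightarrow> rat" where
  "bernoulli n = fact n * fps_nth (fps_X / (fps_exp 1 - 1)) n"

text \<open>
  The divisor has zero constant term, so the quotient above is not multiplication by an inverse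
  power series; the following confirms that it is the intended one.
\<close>

lemma bernoulli_egf:
  "Abs_fps (\<lambda>n. bernoulli n / fact n) * (fps_exp 1 - 1) = fps_X"
proof -
  let ?d = "fps_exp 1 - 1 :: rat fps"
  have nth1: "fps_nth ?d 1 = 1" by simp
  hence nz: "?d \<noteq> 0" by force
  have "subdegree ?d = 1" by (rule subdegreeI) auto
  hence "?d dvd fps_X" using nz by (simp add: fps_dvd_iff)
  moreover have "Abs_fps (\<lambda>n. bernoulli n / fact n) = fps_X / ?d"
    by (simp add: fps_eq_iff bernoulli_def)
  ultimately show ?thesis by simp
qed

definition p_integral :: "nat \<Rightarrow> rat \<Rightarrow> bool" where
  "p_integral p x \<longleftrightarrow> coprime (snd (quotient_of x)) (int p)"

text \<open>
  The congruence is only meaningful between rationals whose denominators are coprime to \<open>p\<close>,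
  hence the first two conjuncts.
\<close>

definition rat_cong :: "nat \<Rightarrow> nat \<Rightarrow> rat \<Rightarrow> rat \<Rightarrow> bool" where
  "rat_cong p m a b \<longleftrightarrow>
     p_integral p a \<and> p_integral p b \<and> p_integral p ((a - b) / of_nat p ^ m)"

end

theory Submission
  imports Defs "HOL-Number_Theory.Residues"
begin

text \<open>
  Write \<open>N = (p - 1) / 2\<close>. Deform the \<open>k\<close>-th summand to \<open>(6 k + 1) t\<^sub>k(a)\<close>, where \<open>a = 0\<close> gives the
  sum in question, and \<open>t\<^sub>k(a)\<close> is obtained by splitting two of the three factors \<open>(1/2)\<^sub>k\<close> in the
  numerator into \<open>((1 + a)/2)\<^sub>k ((1 - a)/2)\<^sub>k\<close> and two of the factors \<open>k!\<close> in the denominator into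
  \<open>(1 + a/4)\<^sub>k (1 - a/4)\<^sub>k\<close>. A WZ pair with step \<open>a \<mapsto> a - 4\<close> shows that for odd \<open>a = 2 j + 1 \<le> p\<close>
  the deformed sum equals \<open>(-1)\<^sup>j a\<close>. Multiplied by \<open>Q(a) = \<Prod> (1 - (a / 4 i)\<^sup>2)\<close>, the deformed sum
  is a polynomial in \<open>a\<^sup>2\<close> of degree at most \<open>N\<close>, so Lagrange interpolation at these \<open>N + 1\<close> odd
  squares expresses the original sum exactly as \<open>p C(2N,N) / 16\<^sup>N\<close> times \<open>\<Sum> C(p, 2m) Q(p - 4m)\<close>
  over \<open>m \<le> N\<close>. The summands with \<open>m > 0\<close> are divisible by \<open>p\<^sup>2\<close>.

  Let \<open>H\<^sub>r = \<Sum> 1 / i\<^sup>r\<close> over \<open>i \<le> N\<close>. Expanding modulo \<open>p\<^sup>4\<close> leaves \<open>H\<^sub>2\<close>, \<open>H\<^sub>3\<close> and a double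
  harmonic sum. Reflections \<open>i \<mapsto> p - i\<close> turn all of them into multiples of \<open>H\<^sub>3\<close>, and Faulhaber's
  formula at \<open>N + 1 \<equiv> 1/2\<close> gives \<open>H\<^sub>3 \<equiv> -2 B\<^bsub>p-3\<^esub>\<close> modulo \<open>p\<close>.
\<close>

section \<open>A WZ pair\<close>

lemma of_nat_odd_neq_0 [simp]: "2 * of_nat n + 1 \<noteq> (0 :: 'a::semiring_char_0)"
  using of_nat_eq_0_iff[of "2 * n + 1", where 'a = 'a] by (simp add: add.commute)

lemma of_nat_double_Suc_neq_0 [simp]: "2 * of_nat n + 2 \<noteq> (0 :: 'a::semiring_char_0)"
  using of_nat_eq_0_iff[of "2 * n + 2", where 'a = 'a]
  by (simp only: of_nat_add of_nat_mult of_nat_numeral)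

lemma of_nat_odd_neq_4_mult: "2 * of_nat n + 1 \<noteq> (4 * of_int k :: 'a::ring_char_0)"
proof
  assume "2 * of_nat n + 1 = (4 * of_int k :: 'a)"
  then have "(of_int (2 * int n + 1) :: 'a) = of_int (4 * k)" by simp
  then have "2 * int n + 1 = 4 * k" by (simp only: of_int_eq_iff)
  then show False by presburger
qed

definition wz_ratio :: "'a::field_char_0 \<Rightarrow> nat \<Rightarrow> 'a" where
  "wz_ratio a k = (2 * of_nat k + 1 - a) * (2 * of_nat k + 1 + a) * (2 * of_nat k + 1) /
     ((4 * of_nat k + 4 - a) * (4 * of_nat k + 4 + a) * (2 * of_nat k + 2))"

definition wz_term :: "'a::field_char_0 \<Rightarrow> nat \<Rightarrow> 'a" where
  "wz_term a k = (\<Prod>i<k. wz_ratio a i)"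

definition wz_certificate :: "'a::field_char_0 \<Rightarrow> nat \<Rightarrow> 'a" where
  "wz_certificate a k = 2 * of_nat k * (2 * of_nat k - 1) * (4 * of_nat k + a) /
     (a * (2 * of_nat k + a - 1) * (2 * of_nat k + a - 3)) * wz_term a k"

lemma wz_term_0 [simp]: "wz_term a 0 = 1"
  by (simp add: wz_term_def)

lemma wz_term_Suc: "wz_term a (Suc k) = wz_term a k * wz_ratio a k"
  by (simp add: wz_term_def)

lemma central_binomial_Suc:
  "of_nat (2 * Suc k choose Suc k) =
     (of_nat (2 * k choose k) * (4 * (2 * of_nat k + 1) / (2 * of_nat k + 2)) :: 'a::field_char_0)"
proof -
  let ?B = "2 * k choose k" and ?B' = "2 * Suc k choose Suc k"
  have "(2 * k + 2) * ?B' = 2 * (Suc k * ?B')"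
    by (simp del: binomial_Suc_Suc)
  also have "\<dots> = 4 * (Suc k * (Suc (2 * k) choose k))"
    using Suc_times_binomial[of k "Suc (2 * k)"] by (simp del: binomial_Suc_Suc)
  also have "Suc k * (Suc (2 * k) choose k) = Suc (2 * k) * ?B"
    using binomial_absorb_comp[of "Suc (2 * k)" k] by (simp del: binomial_Suc_Suc)
  finally have "?B' * (2 * k + 2) = ?B * (4 * (2 * k + 1))"
    by (simp only: Suc_eq_plus1 mult_ac)
  then have "of_nat (?B' * (2 * k + 2)) = (of_nat (?B * (4 * (2 * k + 1))) :: 'a)"
    by (rule arg_cong)
  then have "of_nat ?B' * (2 * of_nat k + 2) = (of_nat ?B * (4 * (2 * of_nat k + 1)) :: 'a)"
    by (simp only: of_nat_mult of_nat_add of_nat_numeral of_nat_1)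
  then show ?thesis
    by (simp add: nonzero_eq_divide_eq del: binomial_Suc_Suc)
qed

lemma wz_term_at_0: "wz_term 0 k = of_nat (2 * k choose k) ^ 3 / 256 ^ k"
proof (induction k)
  case (Suc k)
  define r s :: 'a where "r = 2 * of_nat k + 1" and "s = 2 * of_nat k + 2"
  have "4 * of_nat k + 4 = 2 * s" by (simp add: s_def)
  then have ratio: "wz_ratio 0 k = (4 * r / s) ^ 3 / (256 :: 'a)"
    unfolding wz_ratio_def r_def[symmetric] s_def[symmetric] diff_0_right add_0_right
    by (simp add: power3_eq_cube mult.assoc)
  show ?case
    unfolding wz_term_Suc Suc.IH ratio central_binomial_Suc r_def[symmetric] s_def[symmetric]
    by (simp only: power_mult_distrib power_Suc times_divide_times_eq mult.commute)
qed simp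

lemma wz_term_odd_eq_0: "j < k \<Longrightarrow> wz_term (2 * of_nat j + 1) k = 0"
  unfolding wz_term_def by (rule prod_zero) (auto simp: wz_ratio_def)

context
  fixes a :: "'a::field_char_0"
  assumes not_multiple_of_4: "\<And>k. a \<noteq> 4 * of_int k"
    and no_pole: "\<And>k. 2 * of_nat k + a \<noteq> 3"
begin

lemma wz_argument_nonzero: "a \<noteq> 0" "a - 4 \<noteq> 0"
  using not_multiple_of_4[of 0] not_multiple_of_4[of 1] by simp_all

lemma wz_factors_nonzero:
  "2 * of_nat k + 2 \<noteq> (0 :: 'a)" "4 * of_nat k + 4 + a \<noteq> 0" "4 * of_nat k + a \<noteq> 0"
  "4 * of_nat k + 4 - a \<noteq> 0" "4 * of_nat k + 8 - a \<noteq> 0"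
  "2 * of_nat k + a - 3 \<noteq> 0" "2 * of_nat k + a - 1 \<noteq> 0" "2 * of_nat k + 1 + a \<noteq> 0"
proof -
  show "2 * of_nat k + 2 \<noteq> (0 :: 'a)" by simp
  show "4 * of_nat k + 4 + a \<noteq> 0"
    using not_multiple_of_4[of "- int k - 1"] by (auto simp: algebra_simps eq_neg_iff_add_eq_0)
qed (use not_multiple_of_4[of "- int k"] not_multiple_of_4[of "int k + 1"]
    not_multiple_of_4[of "int k + 2"] no_pole[of k] no_pole[of "k + 1"] no_pole[of "k + 2"] in
  \<open>auto simp: algebra_simps add_eq_0_iff\<close>)

lemma wz_term_shift:
  "wz_term (a - 4) k = wz_term a k *
    ((2 * of_nat k + 1 - a) * (2 * of_nat k + 3 - a) * (4 - a) * (4 * of_nat k + a) /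
     ((2 * of_nat k + a - 1) * (2 * of_nat k + a - 3) * (4 * of_nat k + 4 - a) * a))"
proof (induction k)
  case 0
  have "(1 - a) * (3 - a) = (a - 1) * (a - 3)" by (simp add: algebra_simps)
  then show ?case using wz_argument_nonzero wz_factors_nonzero[of 0] by simp
next
  case (Suc k)
  define q :: 'a where "q = of_nat k"
  note nonzero = wz_argument_nonzero wz_factors_nonzero[of k, folded q_def]
  have ratio: "wz_ratio (a - 4) k = (2 * q + 5 - a) * (2 * q + a - 3) * (2 * q + 1) /
      ((4 * q + 8 - a) * (4 * q + a) * (2 * q + 2))"
    by (simp add: wz_ratio_def q_def algebra_simps)
  have shifted: "2 * of_nat (Suc k) + 1 - a = 2 * q + 3 - a"
    "2 * of_nat (Suc k) + 3 - a = 2 * q + 5 - a"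
    "4 * of_nat (Suc k) + a = 4 * q + 4 + a" "2 * of_nat (Suc k) + a - 1 = 2 * q + 1 + a"
    "2 * of_nat (Suc k) + a - 3 = 2 * q + a - 1" "4 * of_nat (Suc k) + 4 - a = 4 * q + 8 - a"
    by (simp_all add: q_def)
  show ?case
    unfolding wz_term_Suc Suc.IH ratio shifted unfolding wz_ratio_def q_def[symmetric]
    using nonzero by (simp add: mult_ac)
qed

lemma wz_pair:
  "(6 * of_nat k + 1) * wz_term a k / a - (6 * of_nat k + 1) * wz_term (a - 4) k / (a - 4) =
     4 * (wz_certificate a k - wz_certificate a (Suc k))"
proof -
  define q :: 'a where "q = of_nat k"
  note nonzero = wz_argument_nonzero wz_factors_nonzero[of k, folded q_def]
  have shifted: "2 * of_nat (Suc k) = 2 * q + 2" "2 * q + 2 - 1 = 2 * q + 1"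
    "4 * of_nat (Suc k) + a = 4 * q + 4 + a" "2 * q + 2 + a - 1 = 2 * q + 1 + a"
    "2 * q + 2 + a - 3 = 2 * q + a - 1"
    by (simp_all add: q_def)
  have next_certificate: "wz_certificate a (Suc k) =
      (2 * q + 1)\<^sup>2 * (2 * q + 1 - a) / (a * (2 * q + a - 1) * (4 * q + 4 - a)) * wz_term a k"
    unfolding wz_certificate_def wz_term_Suc wz_ratio_def shifted q_def[symmetric]
    using nonzero by (simp add: power2_eq_square mult_ac)
  have shifted_term: "wz_term (a - 4) k / (a - 4) =
      - ((2 * q + 1 - a) * (2 * q + 3 - a) * (4 * q + a) /
        ((2 * q + a - 1) * (2 * q + a - 3) * (4 * q + 4 - a) * a)) * wz_term a k"
    unfolding wz_term_shift q_def[symmetric]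
    using nonzero by (simp add: divide_simps) (simp add: algebra_simps)
  have certificate: "wz_certificate a k =
      2 * q * (2 * q - 1) * (4 * q + a) / (a * (2 * q + a - 1) * (2 * q + a - 3)) * wz_term a k"
    by (simp add: wz_certificate_def q_def)
  show ?thesis
    unfolding q_def[symmetric] times_divide_eq_right[symmetric]
      shifted_term certificate next_certificate
    using nonzero
    by (simp add: divide_simps power2_eq_square) (simp add: algebra_simps)
qed

lemma wz_sum_shift:
  assumes "wz_term a n = 0"
  shows "(\<Sum>k<n. (6 * of_nat k + 1) * wz_term a k) / a =
    (\<Sum>k<n. (6 * of_nat k + 1) * wz_term (a - 4) k) / (a - 4)"
proof -
  have "(\<Sum>k<n. (6 * of_nat k + 1) * wz_term a k) / a -
      (\<Sum>k<n. (6 * of_nat k + 1) * wz_term (a - 4) k) / (a - 4) =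
      4 * (\<Sum>k<n. wz_certificate a k - wz_certificate a (Suc k))"
    by (simp add: sum_divide_distrib sum_subtractf[symmetric] wz_pair sum_distrib_left)
  also have "\<dots> = 4 * (wz_certificate a 0 - wz_certificate a n)"
    by (simp only: sum_lessThan_telescope')
  also have "\<dots> = 0"
    by (simp add: wz_certificate_def assms)
  finally show ?thesis by simp
qed

end

lemma wz_sum_odd:
  assumes "j < n"
  shows "(\<Sum>k<n. (6 * of_nat k + 1) * wz_term (2 * of_nat j + 1) k) =
    (- 1) ^ j * (2 * of_nat j + 1 :: 'a::field_char_0)"
  using assms
proof (induction j rule: induct_nat_012)
  case 0
  have "(\<Sum>k<n. (6 * of_nat k + 1) * wz_term (1 :: 'a) k) = (\<Sum>k<1. (6 * of_nat k + 1) * wz_term 1 k)"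
    using 0 wz_term_odd_eq_0[of 0, where 'a = 'a] by (intro sum.mono_neutral_right) auto
  then show ?case by simp
next
  case 1
  have "(\<Sum>k<n. (6 * of_nat k + 1) * wz_term (3 :: 'a) k) = (\<Sum>k<2. (6 * of_nat k + 1) * wz_term 3 k)"
    using 1 wz_term_odd_eq_0[of 1, where 'a = 'a] by (intro sum.mono_neutral_right) auto
  then show ?case by (simp add: eval_nat_numeral wz_term_Suc wz_ratio_def)
next
  case (ge2 j)
  define a :: 'a where "a = 2 * of_nat (Suc (Suc j)) + 1"
  have "a \<noteq> 4 * of_int k" for k
    unfolding a_def by (rule of_nat_odd_neq_4_mult)
  moreover have "2 * of_nat k + a \<noteq> 3" for k
    using of_nat_double_Suc_neq_0[of "k + j", where 'a = 'a] by (auto simp: a_def algebra_simps)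
  moreover have "wz_term a n = 0"
    unfolding a_def using ge2.prems by (rule wz_term_odd_eq_0)
  ultimately have "(\<Sum>k<n. (6 * of_nat k + 1) * wz_term a k) / a =
      (\<Sum>k<n. (6 * of_nat k + 1) * wz_term (a - 4) k) / (a - 4)"
    by (rule wz_sum_shift)
  moreover have "a - 4 = 2 * of_nat j + 1" by (simp add: a_def)
  moreover have "a \<noteq> 0" unfolding a_def by (rule of_nat_odd_neq_0)
  moreover have "(\<Sum>k<n. (6 * of_nat k + 1) * wz_term (2 * of_nat j + 1 :: 'a) k) =
      (- 1) ^ j * (2 * of_nat j + 1)"
    using ge2 by simp
  ultimately have "(\<Sum>k<n. (6 * of_nat k + 1) * wz_term a k) = (- 1) ^ j * a"
    by (simp add: nonzero_divide_eq_eq)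
  then show ?case by (simp add: a_def)
qed

section \<open>Interpolation at odd squares\<close>

definition lagrange_basis :: "'b set \<Rightarrow> ('b \<Rightarrow> 'a::field) \<Rightarrow> 'b \<Rightarrow> 'a poly" where
  "lagrange_basis A x j = (\<Prod>i\<in>A - {j}. Polynomial.smult (1 / (x j - x i)) [:- x i, 1:])"

lemma poly_lagrange_basis:
  "poly (lagrange_basis A x j) z = (\<Prod>i\<in>A - {j}. (z - x i) / (x j - x i))"
  by (simp add: lagrange_basis_def poly_prod diff_divide_distrib)

lemma poly_lagrange_basis_node:
  assumes "finite A" "inj_on x A" "j \<in> A" "k \<in> A"
  shows "poly (lagrange_basis A x j) (x k) = (if k = j then 1 else 0)"
proof (cases "k = j")
  case True
  have "x j - x i \<noteq> 0" if "i \<in> A - {j}" for i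
    using that assms by (auto simp: inj_on_def)
  then show ?thesis
    unfolding poly_lagrange_basis using True by (simp add: prod.neutral)
qed (use assms in \<open>auto simp: poly_lagrange_basis intro!: prod_zero\<close>)

lemma degree_lagrange_basis:
  assumes "finite A" "j \<in> A"
  shows "degree (lagrange_basis A x j) < card A"
proof -
  have "degree (lagrange_basis A x j) \<le> (\<Sum>i\<in>A - {j}. 1)"
    unfolding lagrange_basis_def using assms
    by (intro order.trans[OF degree_prod_sum_le] sum_mono) (auto simp: degree_smult_eq)
  also have "\<dots> < card A"
    using assms by (simp only: card_eq_sum[symmetric] card_Diff1_less)
  finally show ?thesis .
qed

lemma lagrange_interpolation:
  fixes p :: "'a :: field poly" and x :: "'b \<Rightarrow> 'a"
  assumes finite: "finite A" and inj: "inj_on x A" and degree: "degree p < card A"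
  shows "poly p z = (\<Sum>j\<in>A. poly p (x j) * (\<Prod>i\<in>A - {j}. (z - x i) / (x j - x i)))"
proof -
  define q where "q = (\<Sum>j\<in>A. Polynomial.smult (poly p (x j)) (lagrange_basis A x j))"
  have degree_q: "degree q < card A"
    unfolding q_def using finite degree
    by (intro degree_sum_less le_less_trans[OF degree_smult_le] degree_lagrange_basis) auto
  have "p = q"
  proof (rule poly_eqI_degree)
    fix y assume "y \<in> x ` A"
    then obtain k where node: "k \<in> A" "y = x k" by auto
    have "poly q y = (\<Sum>j\<in>A. if k = j then poly p (x j) else 0)"
      unfolding q_def poly_sum using finite inj node
      by (intro sum.cong) (auto simp: poly_lagrange_basis_node)
    then show "poly p y = poly q y"
      using node finite by simp
  qed (use degree degree_q inj in \<open>simp_all add: card_image\<close>)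
  then have "poly p z = poly q z" by (rule arg_cong)
  then show ?thesis by (simp only: q_def poly_sum poly_smult poly_lagrange_basis)
qed

text \<open>A partial product of \<open>sin (\<pi> a / 4) / (\<pi> a / 4)\<close>.\<close>

definition sine_prod :: "nat \<Rightarrow> 'a::field_char_0 \<Rightarrow> 'a" where
  "sine_prod N a = (\<Prod>i=1..N. 1 - (a / (4 * of_nat i))\<^sup>2)"

definition wz_summand_poly :: "nat \<Rightarrow> nat \<Rightarrow> 'a::field_char_0 poly" where
  "wz_summand_poly N k = (\<Prod>i<N.
     if i < k
     then Polynomial.smult ((2 * of_nat i + 1) / ((4 * of_nat (Suc i))\<^sup>2 * (2 * of_nat i + 2)))
       [:(2 * of_nat i + 1)\<^sup>2, - 1:]
     else [:1, - 1 / (4 * of_nat (Suc i))\<^sup>2:])"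

lemma degree_wz_summand_poly: "degree (wz_summand_poly N k) \<le> N"
proof -
  have "degree (wz_summand_poly N k) \<le> (\<Sum>i<N. 1)"
    unfolding wz_summand_poly_def
    by (intro order.trans[OF degree_prod_sum_le] sum_mono)
       (auto intro: order.trans[OF degree_smult_le])
  then show ?thesis by simp
qed

lemma sine_factor_mult_wz_ratio:
  assumes "a\<^sup>2 \<noteq> (4 * of_nat (Suc i))\<^sup>2"
  shows "(1 - (a / (4 * of_nat (Suc i)))\<^sup>2) * wz_ratio a i =
    (2 * of_nat i + 1) / ((4 * of_nat (Suc i))\<^sup>2 * (2 * of_nat i + 2)) *
      ((2 * of_nat i + 1)\<^sup>2 - a\<^sup>2 :: 'a::field_char_0)"
proof -
  define s :: 'a where "s = 4 * of_nat (Suc i)"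
  have s_nonzero: "s \<noteq> 0" by (simp add: s_def del: of_nat_Suc)
  have s_eq: "4 * of_nat i + 4 = s" by (simp add: s_def)
  have "s\<^sup>2 - a\<^sup>2 = (s - a) * (s + a)"
    by (simp add: algebra_simps power2_eq_square)
  moreover have "s\<^sup>2 - a\<^sup>2 \<noteq> 0" using assms by (simp add: s_def)
  ultimately have factors_nonzero: "s - a \<noteq> 0" "s + a \<noteq> 0" by auto
  have "1 - (a / s)\<^sup>2 = (s - a) * (s + a) / s\<^sup>2"
    using s_nonzero by (simp add: field_simps power2_eq_square)
  moreover have "(2 * of_nat i + 1 - a) * (2 * of_nat i + 1 + a) = (2 * of_nat i + 1)\<^sup>2 - a\<^sup>2"
    by (simp add: algebra_simps power2_eq_square)
  ultimately show ?thesis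
    unfolding wz_ratio_def s_eq s_def[symmetric] using factors_nonzero by simp
qed

lemma poly_wz_summand_poly:
  assumes "k \<le> N" and not_pole: "\<And>i. i < N \<Longrightarrow> a\<^sup>2 \<noteq> (4 * of_nat (Suc i))\<^sup>2"
  shows "poly (wz_summand_poly N k) (a\<^sup>2) = sine_prod N a * wz_term a k"
proof -
  have "sine_prod N a * wz_term a k =
      (\<Prod>i<N. 1 - (a / (4 * of_nat (Suc i)))\<^sup>2) * (\<Prod>i<N. if i < k then wz_ratio a i else 1)"
    unfolding sine_prod_def wz_term_def One_nat_def prod.atLeast1_atMost_eq using \<open>k \<le> N\<close>
    by (intro arg_cong2[where f = "(*)"] refl prod.mono_neutral_cong_left) auto
  also have "\<dots> = (\<Prod>i<N. if i < k
      then (2 * of_nat i + 1) / ((4 * of_nat (Suc i))\<^sup>2 * (2 * of_nat i + 2)) *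
        ((2 * of_nat i + 1)\<^sup>2 - a\<^sup>2)
      else 1 - (a / (4 * of_nat (Suc i)))\<^sup>2)"
    unfolding prod.distrib[symmetric]
    using sine_factor_mult_wz_ratio[OF not_pole] by (intro prod.cong) auto
  also have "\<dots> = poly (wz_summand_poly N k) (a\<^sup>2)"
  proof -
    have "poly (Polynomial.smult c [:u, - 1:]) x = c * (u - x)" "poly [:1, - 1 / v:] x = 1 - x / v"
      for c u v x :: 'a by (simp_all add: algebra_simps)
    then show ?thesis
      by (simp only: wz_summand_poly_def poly_prod if_distrib[where f = "\<lambda>q. poly q _"]
          power_divide)
  qed
  finally show ?thesis ..
qed

lemma odd_square_eq_iff:
  "(2 * of_nat i + 1 :: 'a::field_char_0)\<^sup>2 = (2 * of_nat j + 1)\<^sup>2 \<longleftrightarrow> i = j"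
proof -
  have "(2 * of_nat k + 1 :: 'a)\<^sup>2 = of_nat ((2 * k + 1)\<^sup>2)" for k
    by (simp add: add.commute)
  then show ?thesis by (simp only: of_nat_eq_iff power2_eq_iff_nonneg) simp
qed

lemma odd_square_neq: "(2 * of_nat j + 1 :: 'a::field_char_0)\<^sup>2 \<noteq> (4 * of_nat i)\<^sup>2"
  using of_nat_odd_neq_4_mult[of j "int i", where 'a = 'a]
    of_nat_odd_neq_4_mult[of j "- int i", where 'a = 'a]
  unfolding power2_eq_iff by simp

lemma wz_sum_interpolation:
  "(\<Sum>k\<le>N. (6 * of_nat k + 1) * wz_term (0 :: 'a::field_char_0) k) =
   (\<Sum>j\<le>N. (- 1) ^ j * (2 * of_nat j + 1) *
     (\<Prod>i\<in>{..N} - {j}. (2 * of_nat i + 1)\<^sup>2 / ((2 * of_nat i + 1)\<^sup>2 - (2 * of_nat j + 1)\<^sup>2)) *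
     sine_prod N (2 * of_nat j + 1))"
proof -
  define S where "S a = (\<Sum>k\<le>N. (6 * of_nat k + 1) * wz_term a k)" for a :: 'a
  define p :: "'a poly" where
    "p = (\<Sum>k\<le>N. Polynomial.smult (6 * of_nat k + 1) (wz_summand_poly N k))"
  define node :: "nat \<Rightarrow> 'a" where "node j = (2 * of_nat j + 1)\<^sup>2" for j
  have poly_p: "poly p (a\<^sup>2) = sine_prod N a * S a"
    if "\<And>i. i < N \<Longrightarrow> a\<^sup>2 \<noteq> (4 * of_nat (Suc i))\<^sup>2" for a
    using that by (simp add: p_def S_def poly_sum poly_wz_summand_poly sum_distrib_left mult_ac)
  have "degree p < card {..N}"
    unfolding p_def using degree_wz_summand_poly[where 'a = 'a and N = N]
    by (intro degree_sum_less le_less_trans[OF degree_smult_le]) (auto simp: less_Suc_eq_le)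
  then have "poly p 0 =
      (\<Sum>j\<le>N. poly p (node j) * (\<Prod>i\<in>{..N} - {j}. (0 - node i) / (node j - node i)))"
    by (intro lagrange_interpolation) (auto simp: inj_on_def node_def odd_square_eq_iff)
  also have "\<dots> = (\<Sum>j\<le>N. (- 1) ^ j * (2 * of_nat j + 1) *
      (\<Prod>i\<in>{..N} - {j}. node i / (node i - node j)) * sine_prod N (2 * of_nat j + 1))"
  proof (rule sum.cong)
    fix j assume "j \<in> {..N}"
    then have "S (2 * of_nat j + 1) = (- 1) ^ j * (2 * of_nat j + 1)"
      using wz_sum_odd[of j "Suc N", where 'a = 'a] by (simp add: S_def lessThan_Suc_atMost)
    then have "poly p (node j) = (- 1) ^ j * (2 * of_nat j + 1) * sine_prod N (2 * of_nat j + 1)"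
      unfolding node_def by (subst poly_p[OF odd_square_neq]) simp
    moreover have "(0 - node i) / (node j - node i) = node i / (node i - node j)" for i
      by (metis diff_0 minus_diff_eq minus_divide_divide)
    ultimately show "poly p (node j) * (\<Prod>i\<in>{..N} - {j}. (0 - node i) / (node j - node i)) =
        (- 1) ^ j * (2 * of_nat j + 1) * (\<Prod>i\<in>{..N} - {j}. node i / (node i - node j)) *
          sine_prod N (2 * of_nat j + 1)" by (simp add: mult_ac)
  qed simp
  also have "poly p 0 = S 0"
    using poly_p[of 0] by (simp add: sine_prod_def del: of_nat_Suc)
  finally show ?thesis by (simp add: S_def node_def)
qed

lemma fact_double_eq_prod_odd:
  "fact (2 * n) = (2 ^ n * fact n * (\<Prod>i<n. 2 * of_nat i + 1) :: 'a::{comm_ring_1, semiring_char_0})"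
  by (induction n) (simp_all add: algebra_simps)

lemma prod_index_diff:
  assumes "j \<le> N"
  shows "(\<Prod>i\<in>{..N} - {j}. of_nat i - of_nat j) =
    (- 1) ^ j * (fact j * fact (N - j) :: 'a::{comm_ring_1, semiring_char_0})"
proof -
  have split: "{..N} - {j} = {..<j} \<union> {j<..N}" using assms by auto
  have "(\<Prod>i\<in>{..N} - {j}. of_nat i - of_nat j :: 'a) =
      (\<Prod>i<j. of_nat i - of_nat j) * (\<Prod>i\<in>{j<..N}. of_nat i - of_nat j)"
    unfolding split by (rule prod.union_disjoint) auto
  also have "(\<Prod>i<j. of_nat i - of_nat j :: 'a) = (\<Prod>i=1..j. - of_nat i)"
    by (rule prod.reindex_bij_witness[of _ "\<lambda>i. j - i" "\<lambda>i. j - i"]) auto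
  also have "\<dots> = (- 1) ^ j * fact j"
    by (simp add: prod_uminus fact_prod)
  also have "(\<Prod>i\<in>{j<..N}. of_nat i - of_nat j :: 'a) = (\<Prod>i=1..N - j. of_nat i)"
    by (rule prod.reindex_bij_witness[of _ "\<lambda>i. i + j" "\<lambda>i. i - j"]) auto
  also have "\<dots> = fact (N - j)"
    by (simp add: fact_prod)
  finally show ?thesis by (simp add: mult.assoc)
qed

lemma prod_index_sum:
  assumes "j \<le> N"
  shows "(\<Prod>i\<in>{..N} - {j}. of_nat i + of_nat j + 1) =
    (fact (N + j + 1) / (fact j * (2 * of_nat j + 1)) :: 'a::field_char_0)"
proof -
  define b :: 'a where "b = 2 * of_nat j + 1"
  have b_nonzero: "b \<noteq> 0" by (simp add: b_def)
  have "(\<Prod>i\<in>{..N} - {j}. of_nat i + of_nat j + 1) * (fact j * b) =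
      fact j * (\<Prod>i\<le>N. of_nat i + of_nat j + 1)"
    using assms by (subst prod.remove[of "{..N}" j]) (auto simp: b_def mult_ac)
  also have "\<dots> = fact (N + j + 1)"
  proof (induction N)
    case (Suc N)
    have "fact (Suc N + j + 1) = ((of_nat (Suc N) + of_nat j + 1) * fact (N + j + 1) :: 'a)"
      by (simp add: add_ac)
    then show ?case
      by (simp only: prod.atMost_Suc mult.assoc[symmetric] Suc.IH) (simp only: mult.commute)
  qed simp
  finally show ?thesis
    unfolding b_def[symmetric] using b_nonzero by (simp add: nonzero_eq_divide_eq)
qed

lemma prod_odd_atMost:
  "(\<Prod>i\<le>N. 2 * of_nat i + 1) = (fact (2 * N + 1) / (2 ^ N * fact N) :: 'a::field_char_0)"
proof -
  have "fact (2 * Suc N) = (2 ^ Suc N * fact (Suc N) * (\<Prod>i\<le>N. 2 * of_nat i + 1) :: 'a)"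
    unfolding lessThan_Suc_atMost[symmetric] by (rule fact_double_eq_prod_odd)
  also have "fact (2 * Suc N) = 2 * of_nat (Suc N) * (fact (2 * N + 1) :: 'a)"
    by (simp add: algebra_simps)
  finally have "fact (2 * N + 1) = (2 ^ N * fact N * (\<Prod>i\<le>N. 2 * of_nat i + 1) :: 'a)"
    by (simp del: of_nat_Suc)
  then show ?thesis by simp
qed

lemma prod_odd_square_diff:
  assumes "j \<le> N"
  shows "(\<Prod>i\<in>{..N} - {j}. (2 * of_nat i + 1)\<^sup>2 - (2 * of_nat j + 1)\<^sup>2) =
    (4 ^ N * ((- 1) ^ j * (fact (N - j) * fact (N + j + 1) / (2 * of_nat j + 1)))
      :: 'a::field_char_0)"
proof -
  have "(2 * of_nat i + 1)\<^sup>2 - (2 * of_nat j + 1)\<^sup>2 =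
      4 * ((of_nat i - of_nat j) * (of_nat i + of_nat j + 1) :: 'a)" for i
    by (simp add: power2_eq_square algebra_simps)
  then have "(\<Prod>i\<in>{..N} - {j}. (2 * of_nat i + 1)\<^sup>2 - (2 * of_nat j + 1 :: 'a)\<^sup>2) =
      4 ^ N * ((- 1) ^ j * (fact j * fact (N - j)) *
        (fact (N + j + 1) / (fact j * (2 * of_nat j + 1))))"
    using assms by (simp add: prod.distrib prod_index_diff prod_index_sum)
  then show ?thesis by simp
qed

lemma interpolation_weight:
  assumes "j \<le> N"
  shows "(- 1) ^ j * (2 * of_nat j + 1) *
      (\<Prod>i\<in>{..N} - {j}. (2 * of_nat i + 1)\<^sup>2 / ((2 * of_nat i + 1)\<^sup>2 - (2 * of_nat j + 1)\<^sup>2)) =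
    ((2 * of_nat N + 1) * of_nat (2 * N choose N) / 16 ^ N * of_nat (2 * N + 1 choose (N - j))
      :: 'a::field_char_0)"
proof -
  define a :: "nat \<Rightarrow> 'a" where "a i = 2 * of_nat i + 1" for i
  have a_nonzero: "a j \<noteq> 0" by (simp add: a_def)
  have numerator: "(\<Prod>i\<in>{..N} - {j}. a i) = fact (2 * N + 1) / (2 ^ N * fact N) / a j"
    using assms a_nonzero prod.remove[of "{..N}" j a] prod_odd_atMost[of N, where 'a = 'a]
    by (simp add: nonzero_eq_divide_eq mult_ac a_def)
  have denominator: "(\<Prod>i\<in>{..N} - {j}. (a i)\<^sup>2 - (a j)\<^sup>2) =
      4 ^ N * ((- 1) ^ j * (fact (N - j) * fact (N + j + 1) / a j))"
    unfolding a_def using assms by (rule prod_odd_square_diff)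
  have "(- 1) ^ j * a j * (\<Prod>i\<in>{..N} - {j}. (a i)\<^sup>2 / ((a i)\<^sup>2 - (a j)\<^sup>2)) =
      (fact (2 * N + 1))\<^sup>2 / (4 ^ N * (2 ^ N)\<^sup>2 * (fact N)\<^sup>2 * (fact (N - j) * fact (N + j + 1)))"
    unfolding prod_dividef prod_power_distrib[symmetric] numerator denominator
    using a_nonzero by (simp add: power2_eq_square mult_ac)
  also have "4 ^ N * (2 ^ N)\<^sup>2 = (16 :: 'a) ^ N"
    by (simp add: power2_eq_square power_mult_distrib[symmetric])
  finally have ratio: "(- 1) ^ j * a j * (\<Prod>i\<in>{..N} - {j}. (a i)\<^sup>2 / ((a i)\<^sup>2 - (a j)\<^sup>2)) =
      (fact (2 * N + 1))\<^sup>2 / (16 ^ N * (fact N)\<^sup>2 * (fact (N - j) * fact (N + j + 1)))" .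
  have "2 * N + 1 - (N - j) = N + j + 1" using assms by simp
  then have "of_nat (2 * N + 1 choose (N - j)) =
      (fact (2 * N + 1) / (fact (N - j) * fact (N + j + 1)) :: 'a)"
    by (simp only: binomial_fact[of "N - j" "2 * N + 1"])
  moreover have "of_nat (2 * N choose N) = (fact (2 * N) / (fact N)\<^sup>2 :: 'a)"
    by (simp add: binomial_fact power2_eq_square)
  moreover have "fact (2 * N + 1) = ((2 * of_nat N + 1) * fact (2 * N) :: 'a)"
    by simp
  ultimately show ?thesis
    using ratio unfolding a_def by (simp add: power2_eq_square mult_ac add_ac)
qed

lemma sum_symmetric_eq_sum_even:
  fixes f :: "nat \<Rightarrow> 'a::comm_monoid_add"
  assumes "\<And>i. i \<le> 2 * N + 1 \<Longrightarrow> f (2 * N + 1 - i) = f i"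
  shows "(\<Sum>i\<le>N. f i) = (\<Sum>m\<le>N. f (2 * m))"
proof (rule sum.reindex_bij_witness)
  let ?fold = "\<lambda>i. if even i then i else 2 * N + 1 - i"
  let ?unfold = "\<lambda>i. if i \<le> N then i else 2 * N + 1 - i"
  fix i assume "i \<in> {..N}"
  then show "?fold i div 2 \<in> {..N}" by auto
  show "?unfold (2 * (?fold i div 2)) = i"
    using \<open>i \<in> {..N}\<close> by (auto elim!: evenE oddE)
  show "f (2 * (?fold i div 2)) = f i"
    using \<open>i \<in> {..N}\<close> assms[of i] by (auto elim!: evenE oddE)
qed (auto split: if_splits)

lemma wz_sum_eq_sine_prod_sum:
  "(\<Sum>k\<le>N. (6 * of_nat k + 1) * wz_term (0 :: 'a::field_char_0) k) =
   (2 * of_nat N + 1) * of_nat (2 * N choose N) / 16 ^ N *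
     (\<Sum>m\<le>N. of_nat (2 * N + 1 choose (2 * m)) * sine_prod N (2 * of_nat N + 1 - 4 * of_nat m))"
proof -
  let ?c = "(2 * of_nat N + 1) * of_nat (2 * N choose N) / 16 ^ N :: 'a"
  define f :: "nat \<Rightarrow> 'a" where
    "f i = of_nat (2 * N + 1 choose i) * sine_prod N (2 * of_nat N + 1 - 2 * of_nat i)" for i
  have "(\<Sum>k\<le>N. (6 * of_nat k + 1) * wz_term (0 :: 'a) k) = (\<Sum>j\<le>N. ?c * f (N - j))"
    unfolding wz_sum_interpolation
  proof (rule sum.cong)
    fix j assume "j \<in> {..N}"
    then have "j \<le> N" by simp
    then have "2 * of_nat N + 1 - 2 * of_nat (N - j) = (2 * of_nat j + 1 :: 'a)"
      by (simp add: of_nat_diff)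
    then have "f (N - j) = of_nat (2 * N + 1 choose (N - j)) * sine_prod N (2 * of_nat j + 1)"
      by (simp only: f_def)
    then show "(- 1) ^ j * (2 * of_nat j + 1) *
        (\<Prod>i\<in>{..N} - {j}. (2 * of_nat i + 1)\<^sup>2 / ((2 * of_nat i + 1)\<^sup>2 - (2 * of_nat j + 1)\<^sup>2)) *
        sine_prod N (2 * of_nat j + 1) = ?c * f (N - j)"
      unfolding interpolation_weight[OF \<open>j \<le> N\<close>] by (simp only: mult.assoc)
  qed simp
  also have "\<dots> = ?c * (\<Sum>i\<le>N. f i)"
    unfolding sum_distrib_left[symmetric]
    using sum.nat_diff_reindex[of f "Suc N"] by (simp add: lessThan_Suc_atMost)
  also have "(\<Sum>i\<le>N. f i) = (\<Sum>m\<le>N. f (2 * m))"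
  proof (rule sum_symmetric_eq_sum_even)
    fix i assume i_le: "i \<le> 2 * N + 1"
    have "sine_prod N (- x) = sine_prod N x" for x :: 'a
      by (simp add: sine_prod_def)
    moreover have "2 * of_nat N + 1 - 2 * of_nat (2 * N + 1 - i) =
        - (2 * of_nat N + 1 - 2 * of_nat i :: 'a)"
      using i_le by (simp add: of_nat_diff)
    ultimately show "f (2 * N + 1 - i) = f i"
      unfolding f_def binomial_symmetric[OF i_le, symmetric] by metis
  qed
  finally show ?thesis by (simp add: f_def)
qed

lemma sine_prod_shift:
  "sine_prod N (a - 4) * ((4 - a) * (4 * of_nat N + a)) =
     sine_prod N a * ((4 * of_nat N + 4 - a) * a)"
proof (induction N)
  case (Suc N)
  define s :: 'a where "s = 4 * of_nat (Suc N)"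
  have s_nonzero: "s \<noteq> 0" by (simp add: s_def del: of_nat_Suc)
  have N_eq: "4 * of_nat N = s - 4" by (simp add: s_def)
  have "1 - (b / s)\<^sup>2 = (s - b) * (s + b) / s\<^sup>2" for b
    using s_nonzero by (simp add: field_simps power2_eq_square)
  then have step: "sine_prod (Suc N) b = sine_prod N b * ((s - b) * (s + b) / s\<^sup>2)" for b
    by (simp add: sine_prod_def s_def del: of_nat_Suc)
  have "sine_prod (Suc N) (a - 4) * ((4 - a) * (s + a)) =
      (sine_prod N (a - 4) * ((4 - a) * (s - 4 + a))) * ((s + 4 - a) * (s + a) / s\<^sup>2)"
    unfolding step by (simp add: mult_ac diff_diff_eq2 add_diff_eq)
  also have "\<dots> = sine_prod (Suc N) a * ((s + 4 - a) * a)"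
    unfolding step Suc.IH[unfolded N_eq] by (simp add: mult_ac)
  finally show ?case by (simp only: s_def)
qed (simp add: sine_prod_def)

definition sine_ratio :: "nat \<Rightarrow> nat \<Rightarrow> 'a::field_char_0" where
  "sine_ratio N m = (2 * of_nat N + 1) / (2 * of_nat N + 1 - 4 * of_nat m) *
     (\<Prod>i<m. (2 * of_nat N + 1 + 4 * of_nat i + 2) / (4 * of_nat i + 2 - 3 * (2 * of_nat N + 1)))"

lemma sine_prod_eq_sine_ratio:
  "sine_prod N (2 * of_nat N + 1 - 4 * of_nat m) = sine_prod N (2 * of_nat N + 1) * sine_ratio N m"
proof (induction m)
  case 0
  show ?case by (simp add: sine_ratio_def)
next
  case (Suc m)
  define P :: 'a where "P = 2 * of_nat N + 1"
  define a where "a = P - 4 * of_nat m"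
  define d where "d = 4 * of_nat m + 2 - 3 * P"
  have a_nonzero: "a \<noteq> 0" "a - 4 \<noteq> 0"
    using of_nat_odd_neq_4_mult[of N "int m", where 'a = 'a]
      of_nat_odd_neq_4_mult[of N "int (Suc m)", where 'a = 'a]
    by (auto simp: a_def P_def algebra_simps)
  have d_nonzero: "d \<noteq> 0"
  proof
    assume "d = 0"
    then have "(of_nat (4 * m + 2) :: 'a) = of_nat (3 * (2 * N + 1))"
      by (simp add: d_def P_def algebra_simps)
    then have "4 * m + 2 = 3 * (2 * N + 1)" by (simp only: of_nat_eq_iff)
    then show False by presburger
  qed
  have "P - 4 * of_nat (Suc m) = a - 4" by (simp add: a_def)
  then have ratio_Suc: "sine_ratio N (Suc m) =
      sine_ratio N m * (a * (P + 4 * of_nat m + 2) / ((a - 4) * d))"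
    using a_nonzero
    unfolding sine_ratio_def P_def[symmetric] prod.lessThan_Suc a_def[symmetric] d_def[symmetric]
    by simp
  have "4 * of_nat N + a = - d" "4 - a = - (a - 4)" "4 * of_nat N + 4 - a = P + 4 * of_nat m + 2"
    by (simp_all add: a_def d_def P_def)
  then have "sine_prod N (a - 4) * ((a - 4) * d) = sine_prod N a * ((P + 4 * of_nat m + 2) * a)"
    using sine_prod_shift[of N a] by (simp only: minus_mult_minus)
  then have "sine_prod N (a - 4) = sine_prod N a * (a * (P + 4 * of_nat m + 2) / ((a - 4) * d))"
    using a_nonzero d_nonzero by (simp add: nonzero_eq_divide_eq mult_ac)
  also have "sine_prod N a = sine_prod N P * sine_ratio N m"
    using Suc.IH by (simp only: a_def P_def)
  finally show ?case
    unfolding ratio_Suc by (simp add: a_def P_def algebra_simps)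
qed

lemma wz_sum_factorization:
  "(\<Sum>k\<le>N. (6 * of_nat k + 1) * wz_term (0 :: 'a::field_char_0) k) =
   (2 * of_nat N + 1) * (of_nat (2 * N choose N) / 16 ^ N *
     (sine_prod N (2 * of_nat N + 1) *
       (1 + (\<Sum>m=1..N. of_nat (2 * N + 1 choose (2 * m)) * sine_ratio N m))))"
proof -
  have "sine_ratio N 0 = (1 :: 'a)" by (simp add: sine_ratio_def)
  then have "1 + (\<Sum>m=1..N. of_nat (2 * N + 1 choose (2 * m)) * sine_ratio N m) =
      (\<Sum>m\<le>N. of_nat (2 * N + 1 choose (2 * m)) * sine_ratio N m :: 'a)"
    by (simp add: atLeast0AtMost[symmetric] sum.atLeast_Suc_atMost)
  then show ?thesis
    unfolding wz_sum_eq_sine_prod_sum sine_prod_eq_sine_ratio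
    by (simp add: sum_distrib_left mult_ac)
qed

lemma prod_odd_reflected:
  "(\<Prod>i=1..N. 2 * of_nat N + 1 - 2 * of_nat i) =
    (fact (2 * N) / (2 ^ N * fact N) :: 'a::field_char_0)"
proof -
  have "(\<Prod>i=1..N. 2 * of_nat N + 1 - 2 * of_nat i) = (\<Prod>i<N. 2 * of_nat i + 1 :: 'a)"
    by (rule prod.reindex_bij_witness[of _ "\<lambda>i. N - i" "\<lambda>i. N - i"]) (auto simp: of_nat_diff)
  then show ?thesis
    using fact_double_eq_prod_odd[of N, where 'a = 'a] by simp
qed

lemma prod_upper_half:
  "(\<Prod>i=1..N. 2 * of_nat N + 1 - of_nat i) = (fact (2 * N) / fact N :: 'a::field_char_0)"
proof -
  have "(\<Prod>i=1..N. 2 * of_nat N + 1 - of_nat i) = (\<Prod>i=0..<N. of_nat (2 * N) - of_nat i :: 'a)"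
    by (rule prod.reindex_bij_witness[of _ "\<lambda>i. i + 1" "\<lambda>i. i - 1"]) (auto simp: of_nat_diff)
  also have "\<dots> = fact N * of_nat (2 * N choose N)"
    by (simp only: gbinomial_mult_fact binomial_gbinomial)
  also have "\<dots> = fact (2 * N) / fact N"
    by (simp add: binomial_fact)
  finally show ?thesis .
qed

lemma central_binomial_eq_prod:
  fixes N :: nat
  defines "P \<equiv> 2 * of_nat N + 1 :: 'a::field_char_0"
  shows "of_nat (2 * N choose N) / 16 ^ N =
    (- 1) ^ N * (\<Prod>i=1..N. 1 + P\<^sup>2 / (4 * of_nat i * (of_nat i - P)))"
proof -
  have "1 + P\<^sup>2 / (4 * of_nat i * (of_nat i - P)) =
      - ((P - 2 * of_nat i)\<^sup>2 / (4 * of_nat i * (P - of_nat i)))"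
    if "i \<in> {1..N}" for i
  proof -
    have "(of_nat (2 * N + 1) :: 'a) \<noteq> of_nat i"
      using that unfolding of_nat_eq_iff by auto
    then have "of_nat i \<noteq> (0 :: 'a)" "P - of_nat i \<noteq> 0" "of_nat i - P \<noteq> 0"
      using that by (auto simp: P_def add.commute)
    then show ?thesis
      by (simp add: divide_simps) (simp add: algebra_simps power2_eq_square)
  qed
  then have "(\<Prod>i=1..N. 1 + P\<^sup>2 / (4 * of_nat i * (of_nat i - P))) =
      (- 1) ^ N * ((\<Prod>i=1..N. P - 2 * of_nat i)\<^sup>2 / (4 ^ N * fact N * (\<Prod>i=1..N. P - of_nat i)))"
    by (simp add: prod_uminus prod_dividef prod.distrib prod_power_distrib fact_prod)
  also have "\<dots> = (- 1) ^ N * (fact (2 * N) / (fact N * fact N) / (4 ^ N * (2 ^ N)\<^sup>2))"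
    unfolding P_def prod_odd_reflected prod_upper_half by (simp add: power2_eq_square)
  also have "4 ^ N * (2 ^ N)\<^sup>2 = (16 :: 'a) ^ N"
    by (simp add: power2_eq_square power_mult_distrib[symmetric])
  finally show ?thesis
    by (simp add: binomial_fact mult.assoc[symmetric] power_mult_distrib[symmetric])
qed

section \<open>Congruences between p-integral rationals\<close>

definition p_unit :: "nat \<Rightarrow> rat \<Rightarrow> bool" where
  "p_unit p x \<longleftrightarrow> x \<noteq> 0 \<and> p_integral p x \<and> p_integral p (1 / x)"

locale rat_prime =
  fixes p :: nat
  assumes prime_p: "prime p"
begin

abbreviation P :: rat where
  "P \<equiv> of_nat p"

lemma p_nonzero [simp]: "p \<noteq> 0"
  using prime_gt_0_nat[OF prime_p] by simp

lemma prime_dvd_int_mult_iff: "int p dvd a * b \<longleftrightarrow> int p dvd a \<or> int p dvd b"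
  using prime_p by (intro prime_dvd_mult_iff) simp

lemma p_integral_iff: "p_integral p x \<longleftrightarrow> (\<exists>a b. \<not> int p dvd b \<and> x = of_int a / of_int b)"
proof -
  have coprime_iff: "coprime b (int p) \<longleftrightarrow> \<not> int p dvd b" for b
    using prime_p coprime_absorb_left[of "int p" b] prime_imp_coprime[of "int p" b]
    by (auto simp: coprime_commute)
  obtain c d where frac: "quotient_of x = (c, d)" by (cases "quotient_of x")
  note frac_props =
    quotient_of_div[OF frac] quotient_of_coprime[OF frac] quotient_of_denom_pos[OF frac]
  have "\<not> int p dvd d" if "\<not> int p dvd b" "x = of_int a / of_int b" for a b
  proof -
    have "b \<noteq> 0" using that by auto
    then have "(of_int (c * b) :: rat) = of_int (a * d)"
      using that frac_props by (simp add: field_simps)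
    then have "d dvd c * b" by (simp only: of_int_eq_iff dvd_triv_right)
    then have "d dvd b" using frac_props by (simp add: coprime_commute coprime_dvd_mult_right_iff)
    then show ?thesis using that dvd_trans by blast
  qed
  then show ?thesis
    unfolding p_integral_def frac snd_conv coprime_iff using frac_props(1) by blast
qed

lemma p_integral_of_int [simp, intro]: "p_integral p (of_int k)"
  using prime_gt_1_nat[OF prime_p] unfolding p_integral_iff by (intro exI[of _ k] exI[of _ 1]) auto

lemma p_integral_of_nat [simp, intro]: "p_integral p (of_nat k)"
  using p_integral_of_int[of "int k"] by simp

lemma p_integral_numeral [simp, intro]: "p_integral p (numeral k)"
  using p_integral_of_nat[of "numeral k"] by simp

lemma p_integral_0 [simp, intro]: "p_integral p 0"
  using p_integral_of_nat[of 0] by simp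

lemma p_integral_1 [simp, intro]: "p_integral p 1"
  using p_integral_of_nat[of 1] by simp

lemma p_integral_mult [intro]:
  assumes "p_integral p x" "p_integral p y"
  shows "p_integral p (x * y)"
proof -
  obtain a b c d where "\<not> int p dvd b" "x = of_int a / of_int b"
    "\<not> int p dvd d" "y = of_int c / of_int d"
    using assms unfolding p_integral_iff by blast
  then show ?thesis
    unfolding p_integral_iff
    by (intro exI[of _ "a * c"] exI[of _ "b * d"]) (simp add: prime_dvd_int_mult_iff)
qed

lemma p_integral_add [intro]:
  assumes "p_integral p x" "p_integral p y"
  shows "p_integral p (x + y)"
proof -
  obtain a b c d where fracs: "\<not> int p dvd b" "x = of_int a / of_int b"
    "\<not> int p dvd d" "y = of_int c / of_int d"
    using assms unfolding p_integral_iff by blast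
  moreover have "b \<noteq> 0" "d \<noteq> 0" using fracs by auto
  ultimately show ?thesis
    unfolding p_integral_iff
    by (intro exI[of _ "a * d + b * c"] exI[of _ "b * d"])
       (simp add: prime_dvd_int_mult_iff field_simps)
qed

lemma p_integral_minus [intro]: "p_integral p x \<Longrightarrow> p_integral p (- x)"
  using p_integral_mult[OF p_integral_of_int[of "- 1"], of x] by simp

lemma p_integral_diff [intro]: "p_integral p x \<Longrightarrow> p_integral p y \<Longrightarrow> p_integral p (x - y)"
  using p_integral_add[of x "- y"] by auto

lemma p_integral_power [intro]: "p_integral p x \<Longrightarrow> p_integral p (x ^ n)"
  by (induction n) auto

lemma p_integral_sum [intro]: "(\<And>i. i \<in> A \<Longrightarrow> p_integral p (f i)) \<Longrightarrow> p_integral p (sum f A)"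
  by (induction A rule: infinite_finite_induct) auto

lemma p_unit_iff:
  "p_unit p x \<longleftrightarrow> (\<exists>a b. \<not> int p dvd a \<and> \<not> int p dvd b \<and> x = of_int a / of_int b)"
proof
  assume "p_unit p x"
  then obtain a b c d where fracs: "\<not> int p dvd b" "x = of_int a / of_int b"
    "\<not> int p dvd d" "1 / x = of_int c / of_int d" and "x \<noteq> 0"
    unfolding p_unit_def p_integral_iff by blast
  then have "of_int (a * c) = (of_int (b * d) :: rat)"
    by (auto simp: field_simps)
  then have "a * c = b * d" by (simp only: of_int_eq_iff)
  then have "\<not> int p dvd a"
    using fracs by (metis dvd_mult2 prime_dvd_int_mult_iff)
  then show "\<exists>a b. \<not> int p dvd a \<and> \<not> int p dvd b \<and> x = of_int a / of_int b"
    using fracs by blast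
next
  assume "\<exists>a b. \<not> int p dvd a \<and> \<not> int p dvd b \<and> x = of_int a / of_int b"
  then obtain a b where fracs: "\<not> int p dvd a" "\<not> int p dvd b" "x = of_int a / of_int b"
    by blast
  moreover have "a \<noteq> 0" "b \<noteq> 0" using fracs by auto
  moreover have "1 / x = of_int b / of_int a" using fracs by simp
  ultimately show "p_unit p x"
    unfolding p_unit_def p_integral_iff by auto
qed

lemma p_unit_nonzero [simp]: "p_unit p x \<Longrightarrow> x \<noteq> 0"
  by (simp add: p_unit_def)

lemma p_unit_integral [intro]: "p_unit p x \<Longrightarrow> p_integral p x"
  by (simp add: p_unit_def)

lemma p_integral_divide [intro]: "p_integral p x \<Longrightarrow> p_unit p y \<Longrightarrow> p_integral p (x / y)"
  using p_integral_mult[of x "1 / y"] by (simp add: p_unit_def)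

lemmas p_integral_intros = p_integral_add p_integral_diff p_integral_minus p_integral_mult
  p_integral_power p_integral_sum p_integral_divide

lemma p_unit_of_nat: "0 < k \<Longrightarrow> k < p \<Longrightarrow> p_unit p (of_nat k)"
  using prime_p unfolding p_unit_iff
  by (intro exI[of _ "int k"] exI[of _ 1]) (auto simp: nat_dvd_not_less not_prime_unit)

lemma p_unit_1 [simp, intro]: "p_unit p 1"
  by (simp add: p_unit_def)

lemma p_unit_minus [intro]: "p_unit p x \<Longrightarrow> p_unit p (- x)"
  using p_integral_minus[of "1 / x"] by (auto simp: p_unit_def)

lemma p_unit_inverse: "p_unit p x \<Longrightarrow> p_unit p (1 / x)"
  by (simp add: p_unit_def)

lemma p_unit_mult [intro]: "p_unit p x \<Longrightarrow> p_unit p y \<Longrightarrow> p_unit p (x * y)"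
  using p_integral_mult[of "1 / x" "1 / y"] by (auto simp: p_unit_def)

lemma p_unit_power [intro]: "p_unit p x \<Longrightarrow> p_unit p (x ^ n)"
  by (induction n) auto

lemma p_unit_fact: "n < p \<Longrightarrow> p_unit p (fact n)"
  by (induction n) (auto simp: p_unit_of_nat simp del: of_nat_Suc)

lemma p_unit_diff_P_mult:
  assumes "p_unit p x" "p_integral p y"
  shows "p_unit p (x - P * y)"
proof -
  obtain a b c d where fracs: "\<not> int p dvd a" "\<not> int p dvd b" "x = of_int a / of_int b"
    "\<not> int p dvd d" "y = of_int c / of_int d"
    using assms unfolding p_unit_iff p_integral_iff by blast
  then have "\<not> int p dvd a * d - int p * (b * c)"
    by (simp add: prime_dvd_int_mult_iff dvd_diff_left_iff)
  moreover have "b \<noteq> 0" "d \<noteq> 0" using fracs by auto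
  ultimately show ?thesis
    using fracs(2,4) unfolding p_unit_iff fracs(3,5)
    by (intro exI[of _ "a * d - int p * (b * c)"] exI[of _ "b * d"])
       (simp add: prime_dvd_int_mult_iff field_simps)
qed

lemma p_unit_diff_P: "p_unit p x \<Longrightarrow> p_unit p (x - P)"
  using p_unit_diff_P_mult[of x 1] by simp

lemma p_unit_P_diff: "p_unit p x \<Longrightarrow> p_unit p (P - x)"
  using p_unit_minus[OF p_unit_diff_P] by simp

lemma rat_cong_iff:
  "rat_cong p m a b \<longleftrightarrow> p_integral p b \<and> (\<exists>z. p_integral p z \<and> a = b + P ^ m * z)"
proof
  assume "rat_cong p m a b"
  then show "p_integral p b \<and> (\<exists>z. p_integral p z \<and> a = b + P ^ m * z)"
    by (auto simp: rat_cong_def intro!: exI[of _ "(a - b) / P ^ m"])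
qed (auto simp: rat_cong_def)

lemma rat_congI:
  "p_integral p b \<Longrightarrow> p_integral p z \<Longrightarrow> a - b = P ^ m * z \<Longrightarrow> rat_cong p m a b"
  unfolding rat_cong_iff by (auto simp: algebra_simps)

lemma rat_cong_refl [intro]: "p_integral p a \<Longrightarrow> rat_cong p m a a"
  by (simp add: rat_cong_def)

lemma rat_cong_integral:
  assumes "rat_cong p m a b"
  shows "p_integral p a" "p_integral p b"
  using assms by (simp_all add: rat_cong_def)

lemma rat_cong_sym: "rat_cong p m a b \<Longrightarrow> rat_cong p m b a"
  using p_integral_minus[of "(a - b) / P ^ m"] by (simp add: rat_cong_def minus_divide_left)

lemma rat_cong_trans [trans]: "rat_cong p m a b \<Longrightarrow> rat_cong p m b c \<Longrightarrow> rat_cong p m a c"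
  using p_integral_add[of "(a - b) / P ^ m" "(b - c) / P ^ m"]
  by (simp add: rat_cong_def add_divide_distrib[symmetric])

lemma rat_cong_add: "rat_cong p m a b \<Longrightarrow> rat_cong p m c d \<Longrightarrow> rat_cong p m (a + c) (b + d)"
  using p_integral_add[of "(a - b) / P ^ m" "(c - d) / P ^ m"]
  by (auto simp: rat_cong_def add_diff_add add_divide_distrib)

lemma rat_cong_minus: "rat_cong p m a b \<Longrightarrow> rat_cong p m (- a) (- b)"
  using p_integral_minus[of "(a - b) / P ^ m"] by (auto simp: rat_cong_def minus_divide_left)

lemma rat_cong_diff: "rat_cong p m a b \<Longrightarrow> rat_cong p m c d \<Longrightarrow> rat_cong p m (a - c) (b - d)"
  using rat_cong_add[of m a b "- c" "- d"] rat_cong_minus[of m c d] by simp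

lemma rat_cong_mult:
  assumes "rat_cong p m a b" "rat_cong p m c d"
  shows "rat_cong p m (a * c) (b * d)"
proof -
  obtain y z where expansions: "p_integral p y" "a = b + P ^ m * y"
    "p_integral p z" "c = d + P ^ m * z"
    using assms unfolding rat_cong_iff by blast
  have "p_integral p (y * d + b * z + P ^ m * y * z)"
    using expansions(1,3) assms[THEN rat_cong_integral(2)]
    by (intro p_integral_add p_integral_mult p_integral_power) auto
  moreover have "a * c - b * d = P ^ m * (y * d + b * z + P ^ m * y * z)"
    unfolding expansions by (simp add: algebra_simps)
  ultimately show ?thesis
    using assms[THEN rat_cong_integral(2)] by (intro rat_congI) auto
qed

lemma rat_cong_power: "rat_cong p m a b \<Longrightarrow> rat_cong p m (a ^ n) (b ^ n)"
  by (induction n) (auto intro: rat_cong_mult)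

lemma rat_cong_divide:
  assumes "rat_cong p m a b" "rat_cong p m c d" "p_unit p c" "p_unit p d"
  shows "rat_cong p m (a / c) (b / d)"
proof -
  have "rat_cong p m (a * d * (1 / (c * d))) (b * c * (1 / (c * d)))"
    using assms by (intro rat_cong_mult rat_cong_sym[OF assms(2)] rat_cong_refl) auto
  then show ?thesis
    using assms by simp
qed

lemma rat_cong_sum:
  "(\<And>i. i \<in> A \<Longrightarrow> rat_cong p m (f i) (g i)) \<Longrightarrow> rat_cong p m (sum f A) (sum g A)"
  by (induction A rule: infinite_finite_induct) (auto intro: rat_cong_add)

lemma rat_cong_P_power_mult:
  assumes "rat_cong p s a b" "m \<le> r + s"
  shows "rat_cong p m (P ^ r * a) (P ^ r * b)"
proof -
  obtain z where expansion: "p_integral p z" "a = b + P ^ s * z"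
    using assms unfolding rat_cong_iff by blast
  have "P ^ r * a - P ^ r * b = P ^ (r + s) * z"
    unfolding expansion(2) by (simp add: algebra_simps power_add)
  also have "\<dots> = P ^ m * (P ^ (r + s - m) * z)"
    using assms(2) by (simp add: mult.assoc[symmetric] power_add[symmetric])
  finally show ?thesis
    using expansion(1) assms(1)[THEN rat_cong_integral(2)] by (intro rat_congI) auto
qed

lemma rat_cong_of_nat: "[a = b] (mod p ^ m) \<Longrightarrow> rat_cong p m (of_nat a) (of_nat b)"
proof -
  assume "[a = b] (mod p ^ m)"
  then obtain k where "int a = int b + int (p ^ m) * k"
    by (metis cong_iff_lin cong_int_iff cong_sym_eq)
  then have "of_int (int a) = (of_int (int b + int (p ^ m) * k) :: rat)" by (rule arg_cong)
  then show ?thesis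
    by (intro rat_congI[of _ "of_int k"]) auto
qed

lemma fermat_rat_cong:
  assumes "0 < k" "k < p"
  shows "rat_cong p 1 (of_nat k ^ (p - 1)) 1"
  using rat_cong_of_nat[of "k ^ (p - 1)" 1 1] fermat_theorem[OF prime_p, of k] assms
  by (simp add: nat_dvd_not_less)

lemma inverse_diff_P_mult_cong:
  assumes "p_unit p x" "p_integral p y"
  shows "rat_cong p 2 (1 / (x - P * y)) (1 / x + P * y / x\<^sup>2)"
proof (rule rat_congI)
  have unit: "p_unit p (x - P * y)" using assms by (rule p_unit_diff_P_mult)
  show "p_integral p (1 / x + P * y / x\<^sup>2)" "p_integral p (y\<^sup>2 / (x\<^sup>2 * (x - P * y)))"
    using assms unit by auto
  show "1 / (x - P * y) - (1 / x + P * y / x\<^sup>2) = P\<^sup>2 * (y\<^sup>2 / (x\<^sup>2 * (x - P * y)))"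
    using assms(1)[THEN p_unit_nonzero] unit[THEN p_unit_nonzero]
    by (simp add: divide_simps power2_eq_square) (simp add: algebra_simps)
qed

lemma inverse_P_diff_cong:
  assumes "p_unit p x"
  shows "rat_cong p 1 (1 / (P - x)) (- (1 / x))"
proof -
  have "rat_cong p 1 (P - x) (- x)"
    using assms by (intro rat_congI[of _ 1]) auto
  then have "rat_cong p 1 (1 / (P - x)) (1 / (- x))"
    using assms by (intro rat_cong_divide p_unit_P_diff) auto
  then show ?thesis by simp
qed

lemma inverse_square_P_diff_cong:
  assumes "p_unit p x"
  shows "rat_cong p 2 (1 / (P - x)\<^sup>2) (1 / x\<^sup>2 + 2 * P / x ^ 3)"
proof -
  have "1 / (P - x)\<^sup>2 = (1 / (x - P))\<^sup>2"
    by (simp add: power_divide power2_commute)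
  also have "rat_cong p 2 \<dots> ((1 / x + P / x\<^sup>2)\<^sup>2)"
    using inverse_diff_P_mult_cong[OF assms, of 1] by (intro rat_cong_power) simp
  also have "rat_cong p 2 \<dots> (1 / x\<^sup>2 + 2 * P / x ^ 3)"
    using assms
    by (intro rat_congI[of _ "1 / x ^ 4"]) (auto simp: eval_nat_numeral field_simps)
  finally show ?thesis .
qed

lemma one_plus_mult_cong:
  assumes "rat_cong p m x (1 + P ^ r * u)" "rat_cong p m y (1 + P ^ r * v)"
    and "p_integral p u" "p_integral p v" "m \<le> 2 * r"
  shows "rat_cong p m (x * y) (1 + P ^ r * (u + v))"
proof -
  have "rat_cong p m (x * y) ((1 + P ^ r * u) * (1 + P ^ r * v))"
    using assms by (intro rat_cong_mult)
  also have "(1 + P ^ r * u) * (1 + P ^ r * v) = 1 + P ^ r * (u + v) + P ^ (r + r) * (u * v)"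
    by (simp add: algebra_simps power_add)
  also have "rat_cong p m \<dots> (1 + P ^ r * (u + v) + P ^ (r + r) * 0)"
    using assms
    by (intro rat_cong_add rat_cong_P_power_mult[of 0] rat_cong_refl) (auto simp: rat_cong_def)
  finally show ?thesis by simp
qed

lemma prod_one_plus_cong:
  assumes "\<And>i. i \<in> A \<Longrightarrow> rat_cong p s (y i) (z i)" and "m \<le> 2 * r" "m \<le> r + s"
  shows "rat_cong p m (\<Prod>i\<in>A. 1 + P ^ r * y i) (1 + P ^ r * (\<Sum>i\<in>A. z i))"
  using assms(1)
proof (induction A rule: infinite_finite_induct)
  case (insert a A)
  have "rat_cong p m (1 + P ^ r * y a) (1 + P ^ r * z a)"
    using insert.prems assms by (intro rat_cong_add rat_cong_P_power_mult) auto
  then have "rat_cong p m ((1 + P ^ r * y a) * (\<Prod>i\<in>A. 1 + P ^ r * y i))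
      (1 + P ^ r * (z a + (\<Sum>i\<in>A. z i)))"
    using insert assms(2) by (intro one_plus_mult_cong insert.IH) (auto dest: rat_cong_integral(2))
  then show ?case using insert.hyps by simp
qed auto

end

section \<open>Harmonic sums modulo powers of an odd prime\<close>

definition harmonic :: "nat \<Rightarrow> nat \<Rightarrow> 'a::field_char_0" where
  "harmonic r n = (\<Sum>i=1..n. 1 / of_nat i ^ r)"

lemma harmonic_Suc: "harmonic r (Suc n) = harmonic r n + 1 / of_nat (Suc n) ^ r"
  by (simp add: harmonic_def)

lemma sum_even_plus_odd:
  fixes f :: "nat \<Rightarrow> 'a::comm_monoid_add"
  shows "(\<Sum>k=1..2 * n. f k) = (\<Sum>i=1..n. f (2 * i)) + (\<Sum>i<n. f (2 * i + 1))"
  by (induction n) (simp_all add: add_ac)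

lemma sum_even_plus_reflected:
  fixes f :: "nat \<Rightarrow> 'a::comm_monoid_add"
  shows "(\<Sum>k=1..2 * n. f k) = (\<Sum>i=1..n. f (2 * i) + f (2 * n + 1 - 2 * i))"
proof -
  have "(\<Sum>i<n. f (2 * i + 1)) = (\<Sum>i=1..n. f (2 * n + 1 - 2 * i))"
    by (rule sum.reindex_bij_witness[of _ "\<lambda>i. n - i" "\<lambda>i. n - i"])
       (auto intro!: arg_cong[of _ _ f])
  then show ?thesis by (simp only: sum_even_plus_odd sum.distrib)
qed

lemma sum_plus_reflected:
  fixes f :: "nat \<Rightarrow> 'a::comm_monoid_add"
  shows "(\<Sum>k=1..2 * n. f k) = (\<Sum>i=1..n. f i + f (2 * n + 1 - i))"
proof -
  have split: "{1..2 * n} = {1..n} \<union> {n + 1..2 * n}" by auto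
  have "(\<Sum>k=1..2 * n. f k) = (\<Sum>k=1..n. f k) + (\<Sum>k=n + 1..2 * n. f k)"
    unfolding split by (rule sum.union_disjoint) auto
  also have "(\<Sum>k=n + 1..2 * n. f k) = (\<Sum>i=1..n. f (2 * n + 1 - i))"
    by (rule sum.reindex_bij_witness[of _ "\<lambda>i. 2 * n + 1 - i" "\<lambda>i. 2 * n + 1 - i"]) auto
  finally show ?thesis by (simp only: sum.distrib)
qed

lemma sum_odd_reciprocals:
  "(\<Sum>i<n. 1 / (2 * of_nat i + 1)) = harmonic 1 (2 * n) - (harmonic 1 n / 2 :: 'a::field_char_0)"
  unfolding harmonic_def power_one_right sum_even_plus_odd
  by (simp add: sum_divide_distrib mult.commute add.commute)

lemma sum_alternating_reciprocals:
  "(\<Sum>i=1..2 * n. (- 1) ^ i / of_nat i) = harmonic 1 n - (harmonic 1 (2 * n) :: 'a::field_char_0)"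
proof -
  have "(\<Sum>i=1..2 * n. (- 1) ^ i / of_nat i) =
      harmonic 1 n / 2 - (\<Sum>i<n. 1 / (2 * of_nat i + 1) :: 'a)"
    unfolding harmonic_def power_one_right sum_even_plus_odd
    by (simp add: sum_divide_distrib sum_negf mult.commute add.commute)
  then show ?thesis by (simp add: sum_odd_reciprocals)
qed

lemma partial_fraction_sum:
  fixes g :: "nat \<Rightarrow> 'a::field_char_0"
  shows "(\<Sum>i\<in>{1..<n}. g i / (of_nat i * of_nat (n - i) * of_nat n)) =
    (\<Sum>i\<in>{1..<n}. (g i + g (n - i)) / of_nat i) / of_nat n ^ 2"
proof -
  have "g i / (of_nat i * of_nat (n - i) * of_nat n) =
      (g i / of_nat i + g i / of_nat (n - i)) / of_nat n ^ 2"
    if "i \<in> {1..<n}" for i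
  proof -
    have "(of_nat n :: 'a) = of_nat i + of_nat (n - i)"
      using that unfolding of_nat_add[symmetric] by simp
    moreover have "of_nat i \<noteq> (0 :: 'a)" "of_nat (n - i) \<noteq> (0 :: 'a)" "of_nat n \<noteq> (0 :: 'a)"
      using that unfolding of_nat_eq_0_iff by auto
    ultimately show ?thesis
      by (simp add: divide_simps power2_eq_square del: of_nat_diff) (simp add: algebra_simps)
  qed
  then have "(\<Sum>i\<in>{1..<n}. g i / (of_nat i * of_nat (n - i) * of_nat n)) =
      ((\<Sum>i\<in>{1..<n}. g i / of_nat i) + (\<Sum>i\<in>{1..<n}. g i / of_nat (n - i))) / of_nat n ^ 2"
    by (simp add: sum_divide_distrib[symmetric] sum.distrib del: of_nat_diff)
  also have "(\<Sum>i\<in>{1..<n}. g i / of_nat (n - i)) = (\<Sum>i\<in>{1..<n}. g (n - i) / of_nat i)"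
    by (rule sum.reindex_bij_witness[of _ "\<lambda>i. n - i" "\<lambda>i. n - i"]) auto
  finally show ?thesis by (simp add: sum.distrib add_divide_distrib)
qed

lemma inner_alternating_triangle_sum:
  "(\<Sum>n=1..2 * N. \<Sum>i\<in>{1..<n}. (- 1) ^ i / (of_nat i * of_nat (n - i) * of_nat n)) =
    - 1 / 2 * (\<Sum>m=1..N. (harmonic 1 (2 * m) - harmonic 1 m) / of_nat m ^ 2)
    - (harmonic 3 N / 4 :: 'a::field_char_0)"
proof -
  define a where "a n = (\<Sum>i\<in>{1..<n}. (- 1) ^ i / of_nat i :: 'a)" for n
  have "(\<Sum>i\<in>{1..<n}. ((- 1) ^ i + (- 1) ^ (n - i)) / of_nat i) = (1 + (- 1) ^ n) * a n" for n
    unfolding a_def sum_distrib_left by (intro sum.cong refl) (auto simp: uminus_power_if)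
  then have "(\<Sum>n=1..2 * N. \<Sum>i\<in>{1..<n}. (- 1) ^ i / (of_nat i * of_nat (n - i) * of_nat n)) =
      (\<Sum>n=1..2 * N. (1 + (- 1) ^ n) * a n / of_nat n ^ 2)"
    by (simp only: partial_fraction_sum)
  also have "\<dots> = (\<Sum>m=1..N. a (2 * m) / (2 * of_nat m ^ 2))"
    unfolding sum_even_plus_odd by (simp add: power_mult_distrib)
  also have "\<dots> = (\<Sum>m=1..N. - 1 / 2 * ((harmonic 1 (2 * m) - harmonic 1 m) / of_nat m ^ 2)
      - 1 / of_nat m ^ 3 / 4)"
  proof (rule sum.cong)
    fix m assume "m \<in> {1..N}"
    then have "{1..2 * m} = insert (2 * m) {1..<2 * m}" by auto
    then have "(\<Sum>i=1..2 * m. (- 1) ^ i / of_nat i) = a (2 * m) + (1 / (2 * of_nat m) :: 'a)"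
      by (simp add: a_def)
    then have "a (2 * m) = - (harmonic 1 (2 * m) - harmonic 1 m) - 1 / (2 * of_nat m)"
      unfolding sum_alternating_reciprocals by simp
    then show "a (2 * m) / (2 * of_nat m ^ 2) =
        - 1 / 2 * ((harmonic 1 (2 * m) - harmonic 1 m) / of_nat m ^ 2) - 1 / of_nat m ^ 3 / 4"
      by (simp add: diff_divide_distrib power2_eq_square power3_eq_cube mult_ac)
  qed simp
  finally show ?thesis
    by (simp only: harmonic_def sum_subtractf sum_distrib_left sum_divide_distrib)
qed

lemma outer_alternating_triangle_sum:
  "(\<Sum>n=1..M. \<Sum>i\<in>{1..<n}. (- 1) ^ n / (of_nat i * of_nat (n - i) * of_nat n)) =
    2 * (\<Sum>n=1..M. (- 1) ^ n * (harmonic 1 (n - 1) / of_nat n ^ 2) :: 'a::field_char_0)"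
proof -
  have "(\<Sum>i\<in>{1..<n}. ((- 1) ^ n + (- 1) ^ n) / of_nat i) =
      2 * ((- 1) ^ n * (harmonic 1 (n - 1) :: 'a))" for n
  proof -
    have "{1..<n} = {1..n - 1}" by auto
    then show ?thesis by (simp add: harmonic_def sum_distrib_left)
  qed
  then show ?thesis
    by (simp only: partial_fraction_sum sum_distrib_left times_divide_eq_right)
qed

locale odd_rat_prime = rat_prime +
  fixes N :: nat
  assumes p_eq: "p = 2 * N + 1"
begin

lemma P_eq: "P = 2 * of_nat N + 1"
  by (subst p_eq) simp

lemma p_unit_2 [simp, intro]: "p_unit p 2"
  using p_unit_of_nat[of 2] prime_gt_1_nat[OF prime_p] p_eq by simp

lemma p_unit_numeral_Bit0 [simp, intro]: "p_unit p (numeral k) \<Longrightarrow> p_unit p (numeral (Num.Bit0 k))"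
  using p_unit_mult[OF p_unit_2, of "numeral k"] by simp

lemma p_unit_index: "k \<in> {1..2 * N} \<Longrightarrow> p_unit p (of_nat k)"
  using p_eq by (intro p_unit_of_nat) auto

lemma p_integral_harmonic: "n \<le> 2 * N \<Longrightarrow> p_integral p (harmonic r n)"
  unfolding harmonic_def by (intro p_integral_intros p_unit_power p_unit_index) auto

lemma inverse_reflect_cong:
  assumes "k \<in> {1..2 * N}"
  shows "rat_cong p 1 (1 / of_nat (p - k)) (- (1 / of_nat k))"
proof -
  have "of_nat (p - k) = P - of_nat k" using assms p_eq by (simp add: of_nat_diff)
  then show ?thesis by (simp only: inverse_P_diff_cong p_unit_index[OF assms])
qed

lemma minus_one_power_reflect: "k \<le> p \<Longrightarrow> (- 1 :: rat) ^ (p - k) = - ((- 1) ^ k)"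
  by (simp add: p_eq uminus_power_if)

lemma sum_reflect: "(\<Sum>k=1..2 * N. f k) = (\<Sum>k=1..2 * N. f (p - k))"
  using sum.atLeastAtMost_rev[of f 1 "2 * N"] by (simp add: p_eq)

lemma inverse_square_sum_cong:
  assumes "p_unit p c"
  shows "rat_cong p 2 (\<Sum>i=1..N. 1 / (c * of_nat i)\<^sup>2 + 1 / (P - c * of_nat i)\<^sup>2)
    (2 / c\<^sup>2 * harmonic 2 N + 2 / c ^ 3 * P * harmonic 3 N)"
proof -
  have "rat_cong p 2 (1 / (c * of_nat i)\<^sup>2 + 1 / (P - c * of_nat i)\<^sup>2)
      (2 / c\<^sup>2 * (1 / of_nat i ^ 2) + 2 / c ^ 3 * P * (1 / of_nat i ^ 3))" if "i \<in> {1..N}" for i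
  proof -
    have unit: "p_unit p (c * of_nat i)"
      using that by (intro p_unit_mult assms p_unit_index) auto
    then have "rat_cong p 2 (1 / (c * of_nat i)\<^sup>2 + 1 / (P - c * of_nat i)\<^sup>2)
        (1 / (c * of_nat i)\<^sup>2 + (1 / (c * of_nat i)\<^sup>2 + 2 * P / (c * of_nat i) ^ 3))"
      by (intro rat_cong_add inverse_square_P_diff_cong rat_cong_refl) auto
    then show ?thesis
      by (simp add: power_mult_distrib)
  qed
  then have "rat_cong p 2 (\<Sum>i=1..N. 1 / (c * of_nat i)\<^sup>2 + 1 / (P - c * of_nat i)\<^sup>2)
      (\<Sum>i=1..N. 2 / c\<^sup>2 * (1 / of_nat i ^ 2) + 2 / c ^ 3 * P * (1 / of_nat i ^ 3))"
    by (rule rat_cong_sum)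
  then show ?thesis
    by (simp only: harmonic_def sum.distrib sum_distrib_left)
qed

lemma harmonic_2_half_cong:
  assumes "p > 3"
  shows "rat_cong p 2 (harmonic 2 N) (- 7 / 6 * P * harmonic 3 N)"
proof -
  let ?H2 = "harmonic 2 N" and ?H3 = "harmonic 3 N" and ?T = "\<Sum>k=1..2 * N. 1 / of_nat k ^ 2 :: rat"
  have unit_3: "p_unit p 3" using p_unit_of_nat[of 3] assms by simp
  have integral: "p_integral p ?H2" "p_integral p ?H3" by (simp_all add: p_integral_harmonic)
  have "?T = (\<Sum>i=1..N. 1 / (1 * of_nat i)\<^sup>2 + 1 / (P - 1 * of_nat i)\<^sup>2)"
    unfolding sum_plus_reflected by (intro sum.cong refl) (auto simp: p_eq of_nat_diff)
  then have "rat_cong p 2 ?T (2 * ?H2 + 2 * P * ?H3)"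
    using inverse_square_sum_cong[of 1] by simp
  moreover have "?T = (\<Sum>i=1..N. 1 / (2 * of_nat i)\<^sup>2 + 1 / (P - 2 * of_nat i)\<^sup>2)"
    unfolding sum_even_plus_reflected by (intro sum.cong refl) (auto simp: p_eq of_nat_diff)
  then have "rat_cong p 2 ?T (1 / 2 * ?H2 + 1 / 4 * P * ?H3)"
    using inverse_square_sum_cong[of 2] by simp
  ultimately have "rat_cong p 2 (2 * ?H2 + 2 * P * ?H3) (1 / 2 * ?H2 + 1 / 4 * P * ?H3)"
    by (blast intro: rat_cong_sym rat_cong_trans)
  then have "rat_cong p 2 (2 / 3 * ((2 * ?H2 + 2 * P * ?H3) - (1 / 2 * ?H2 + 2 * P * ?H3)))
      (2 / 3 * ((1 / 2 * ?H2 + 1 / 4 * P * ?H3) - (1 / 2 * ?H2 + 2 * P * ?H3)))"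
    using integral unit_3
    by (intro rat_cong_mult rat_cong_diff rat_cong_refl p_integral_intros) auto
  then show ?thesis by (simp add: algebra_simps)
qed

lemma central_binomial_cong:
  "rat_cong p 4 ((- 1) ^ N * (of_nat (2 * N choose N) / 16 ^ N))
     (1 + P\<^sup>2 * ((harmonic 2 N + P * harmonic 3 N) / 4))"
proof -
  have "(- 1) ^ N * (of_nat (2 * N choose N) / 16 ^ N) =
      (\<Prod>i=1..N. 1 + P\<^sup>2 * (1 / (4 * of_nat i) * (1 / (of_nat i - P))))"
    unfolding central_binomial_eq_prod
    by (simp add: p_eq mult.assoc[symmetric] power_mult_distrib[symmetric] add.commute)
  also have "rat_cong p 4 \<dots> (1 + P\<^sup>2 * (\<Sum>i=1..N. (1 / of_nat i ^ 2 + P * (1 / of_nat i ^ 3)) / 4))"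
  proof (rule prod_one_plus_cong[where s = 2])
    fix i assume "i \<in> {1..N}"
    then have unit: "p_unit p (of_nat i)" by (intro p_unit_index) auto
    have "rat_cong p 2 (1 / (4 * of_nat i) * (1 / (of_nat i - P)))
        (1 / (4 * of_nat i) * (1 / of_nat i + P / of_nat i ^ 2))"
      using unit inverse_diff_P_mult_cong[OF unit, of 1]
      by (intro rat_cong_mult rat_cong_refl) auto
    also have "\<dots> = (1 / of_nat i ^ 2 + P * (1 / of_nat i ^ 3)) / 4"
      by (simp add: power2_eq_square power3_eq_cube add_divide_distrib distrib_left)
    finally show "rat_cong p 2 (1 / (4 * of_nat i) * (1 / (of_nat i - P)))
        ((1 / of_nat i ^ 2 + P * (1 / of_nat i ^ 3)) / 4)" .
  qed simp_all
  finally show ?thesis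
    by (simp only: harmonic_def sum_divide_distrib[symmetric] sum.distrib sum_distrib_left)
qed

lemma sine_prod_cong: "rat_cong p 4 (sine_prod N P) (1 + P\<^sup>2 * (- harmonic 2 N / 16))"
proof -
  have "sine_prod N P = (\<Prod>i=1..N. 1 + P\<^sup>2 * (- (1 / of_nat i ^ 2) / 16))"
    by (simp add: sine_prod_def power_divide power_mult_distrib mult.commute)
  also have "rat_cong p 4 \<dots> (1 + P\<^sup>2 * (\<Sum>i=1..N. - (1 / of_nat i ^ 2) / 16))"
    by (rule prod_one_plus_cong[where s = 2])
       (auto intro!: rat_cong_refl p_integral_divide p_integral_minus p_unit_power p_unit_index)
  finally show ?thesis
    by (simp only: harmonic_def sum_divide_distrib[symmetric] sum_negf)
qed

lemma harmonic_1_reflect_cong: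
  assumes "n \<le> 2 * N"
  shows "rat_cong p 1 (harmonic 1 (2 * N - n)) (harmonic 1 n)"
proof -
  have "harmonic 1 (2 * N) = (\<Sum>i=1..N. 1 / of_nat i + 1 / of_nat (p - i))"
    by (simp only: harmonic_def power_one_right sum_plus_reflected p_eq)
  also have "rat_cong p 1 \<dots> (\<Sum>i=1..N. 1 / of_nat i + - (1 / of_nat i))"
    by (intro rat_cong_sum rat_cong_add rat_cong_refl inverse_reflect_cong p_integral_intros
        p_unit_index) auto
  finally have whole: "rat_cong p 1 (harmonic 1 (2 * N)) 0" by simp
  have split: "{1..2 * N} = {1..2 * N - n} \<union> {2 * N - n + 1..2 * N}" using assms by auto
  have "harmonic 1 (2 * N) =
      harmonic 1 (2 * N - n) + (\<Sum>k=2 * N - n + 1..2 * N. 1 / of_nat k :: rat)"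
    unfolding harmonic_def power_one_right split by (rule sum.union_disjoint) auto
  also have "(\<Sum>k=2 * N - n + 1..2 * N. 1 / of_nat k :: rat) = (\<Sum>i=1..n. 1 / of_nat (p - i))"
    by (rule sum.reindex_bij_witness[of _ "\<lambda>i. p - i" "\<lambda>i. p - i"]) (use assms p_eq in auto)
  finally have "harmonic 1 (2 * N - n) = harmonic 1 (2 * N) - (\<Sum>i=1..n. 1 / of_nat (p - i) :: rat)"
    by (simp only: eq_diff_eq)
  also have "rat_cong p 1 \<dots> (0 - (\<Sum>i=1..n. - (1 / of_nat i)))"
    using assms by (intro rat_cong_diff whole rat_cong_sum inverse_reflect_cong) auto
  finally show ?thesis by (simp add: harmonic_def sum_negf)
qed

lemma alternating_cubes_cong:
  "rat_cong p 1 (\<Sum>n=1..2 * N. (- 1) ^ n * (1 / of_nat n) ^ 3) (harmonic 3 N / 4)"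
proof -
  have "(\<Sum>n=1..2 * N. (- 1) ^ n * (1 / of_nat n) ^ 3) =
      (\<Sum>i=1..N. (1 / of_nat (2 * i)) ^ 3 - (1 / of_nat (p - 2 * i)) ^ 3 :: rat)"
    unfolding sum_even_plus_reflected p_eq[symmetric]
    by (intro sum.cong refl)
       (use p_eq in \<open>simp add: minus_one_power_reflect del: of_nat_diff of_nat_mult\<close>)
  also have "rat_cong p 1 \<dots> (\<Sum>i=1..N. (1 / of_nat (2 * i)) ^ 3 - (- (1 / of_nat (2 * i))) ^ 3)"
    by (intro rat_cong_sum rat_cong_diff rat_cong_power rat_cong_refl inverse_reflect_cong
        p_integral_intros p_unit_index) auto
  also have "\<dots> = harmonic 3 N / 4"
    unfolding harmonic_def sum_divide_distrib
    by (intro sum.cong refl) (simp add: power_divide power_mult_distrib)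
  finally show ?thesis .
qed

lemma alternating_harmonic_sum_reflect_cong:
  "rat_cong p 1 (\<Sum>n=1..2 * N. (- 1) ^ n * (harmonic 1 (n - 1) / of_nat n ^ 2))
     (- (\<Sum>n=1..2 * N. (- 1) ^ n * (harmonic 1 n / of_nat n ^ 2)))"
proof -
  have "(\<Sum>n=1..2 * N. (- 1) ^ n * (harmonic 1 (n - 1) / of_nat n ^ 2)) =
      (\<Sum>n=1..2 * N. - ((- 1) ^ n) * (harmonic 1 (2 * N - n) * (1 / of_nat (p - n))\<^sup>2) :: rat)"
    unfolding sum_reflect[of "\<lambda>n. (- 1) ^ n * (harmonic 1 (n - 1) / of_nat n ^ 2)"]
  proof (rule sum.cong)
    fix n assume "n \<in> {1..2 * N}"
    then have "n \<le> p" "p - n - 1 = 2 * N - n" using p_eq by auto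
    then show "(- 1) ^ (p - n) * (harmonic 1 (p - n - 1) / of_nat (p - n) ^ 2) =
        - ((- 1) ^ n) * (harmonic 1 (2 * N - n) * (1 / of_nat (p - n))\<^sup>2 :: rat)"
      by (simp add: minus_one_power_reflect power_divide del: of_nat_diff)
  qed simp
  also have "rat_cong p 1 \<dots>
      (\<Sum>n=1..2 * N. - ((- 1) ^ n) * (harmonic 1 n * (- (1 / of_nat n))\<^sup>2))"
    by (intro rat_cong_sum rat_cong_mult[OF rat_cong_refl] rat_cong_mult[OF harmonic_1_reflect_cong]
        rat_cong_power inverse_reflect_cong p_integral_intros) auto
  also have "\<dots> = - (\<Sum>n=1..2 * N. (- 1) ^ n * (harmonic 1 n / of_nat n ^ 2))"
    by (simp add: sum_negf power_divide)
  finally show ?thesis .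
qed

lemma alternating_harmonic_sum_cong:
  "rat_cong p 1 (2 * (\<Sum>n=1..2 * N. (- 1) ^ n * (harmonic 1 (n - 1) / of_nat n ^ 2)))
     (- (harmonic 3 N / 4))"
proof -
  define R where "R = (\<Sum>n=1..2 * N. (- 1) ^ n * (harmonic 1 (n - 1) / of_nat n ^ 2) :: rat)"
  define R' where "R' = (\<Sum>n=1..2 * N. (- 1) ^ n * (harmonic 1 n / of_nat n ^ 2) :: rat)"
  have reflected: "rat_cong p 1 R (- R')"
    unfolding R_def R'_def by (rule alternating_harmonic_sum_reflect_cong)
  then have "rat_cong p 1 (R + R) (R + - R')"
    by (intro rat_cong_add rat_cong_refl rat_cong_integral(1)[OF reflected])
  also have "R + - R' = - (\<Sum>n=1..2 * N. (- 1) ^ n * (1 / of_nat n) ^ 3)"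
    unfolding R_def R'_def sum.distrib[symmetric] sum_negf[symmetric]
  proof (rule sum.cong)
    fix n assume "n \<in> {1..2 * N}"
    then have "harmonic 1 n = harmonic 1 (n - 1) + (1 / of_nat n :: rat)"
      using harmonic_Suc[of 1 "n - 1"] by simp
    then show "(- 1) ^ n * (harmonic 1 (n - 1) / of_nat n ^ 2) +
        - ((- 1) ^ n * (harmonic 1 n / of_nat n ^ 2)) = - ((- 1) ^ n * (1 / of_nat n :: rat) ^ 3)"
      by (simp add: algebra_simps add_divide_distrib power2_eq_square power3_eq_cube)
  qed simp
  also have "rat_cong p 1 \<dots> (- (harmonic 3 N / 4))"
    by (intro rat_cong_minus alternating_cubes_cong)
  finally show ?thesis unfolding R_def[symmetric] mult_2[of R] .
qed

text \<open>
  The reflection \<open>(n, i) \<mapsto> (p - i, p - n)\<close> of the triangle \<open>i < n\<close> exchanges the two sign patterns.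
\<close>

lemma triangle_sum_reflect_cong:
  "rat_cong p 1 (\<Sum>n=1..2 * N. \<Sum>i\<in>{1..<n}. (- 1) ^ i / (of_nat i * of_nat (n - i) * of_nat n))
     (- (\<Sum>n=1..2 * N. \<Sum>i\<in>{1..<n}. (- 1) ^ n / (of_nat i * of_nat (n - i) * of_nat n)))"
proof -
  let ?T = "SIGMA n:{1..2 * N}. {1..<n}"
  have "(\<Sum>n=1..2 * N. \<Sum>i\<in>{1..<n}. (- 1) ^ i / (of_nat i * of_nat (n - i) * of_nat n)) =
      (\<Sum>(n, i)\<in>?T. (- 1) ^ i / (of_nat i * of_nat (n - i) * of_nat n) :: rat)"
    by (rule sum.Sigma) auto
  also have "\<dots> = (\<Sum>(n, i)\<in>?T.
      (- 1) ^ (p - n) / of_nat (n - i) * (1 / of_nat (p - n) * (1 / of_nat (p - i))))"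
    by (rule sum.reindex_bij_witness[of _ "\<lambda>(n, i). (p - i, p - n)" "\<lambda>(n, i). (p - i, p - n)"])
       (auto simp: p_eq mult_ac simp del: of_nat_diff)
  also have "rat_cong p 1 \<dots> (\<Sum>(n, i)\<in>?T.
      - ((- 1) ^ n) / of_nat (n - i) * (- (1 / of_nat n) * - (1 / of_nat i)))"
  proof (rule rat_cong_sum, clarify)
    fix n i assume in_triangle: "n \<in> {1..2 * N}" "i \<in> {1..<n}"
    have sign: "(- 1) ^ (p - n) = (- ((- 1) ^ n) :: rat)"
      using in_triangle p_eq by (intro minus_one_power_reflect) auto
    have "p_unit p (of_nat (n - i))"
      using in_triangle by (intro p_unit_index) auto
    then show "rat_cong p 1
        ((- 1) ^ (p - n) / of_nat (n - i) * (1 / of_nat (p - n) * (1 / of_nat (p - i))))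
        (- ((- 1) ^ n) / of_nat (n - i) * (- (1 / of_nat n) * - (1 / of_nat i)))"
      unfolding sign
      by (intro rat_cong_mult rat_cong_refl inverse_reflect_cong p_integral_intros)
         (use in_triangle in auto)
  qed
  also have "\<dots> = - (\<Sum>(n, i)\<in>?T. (- 1) ^ n / (of_nat i * of_nat (n - i) * of_nat n))"
    by (simp add: sum_negf case_prod_unfold mult_ac del: of_nat_diff)
  also have "(\<Sum>(n, i)\<in>?T. (- 1) ^ n / (of_nat i * of_nat (n - i) * of_nat n)) =
      (\<Sum>n=1..2 * N. \<Sum>i\<in>{1..<n}. (- 1) ^ n / (of_nat i * of_nat (n - i) * of_nat n) :: rat)"
    by (rule sum.Sigma[symmetric]) auto
  finally show ?thesis .
qed

lemma harmonic_difference_sum_cong: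
  "rat_cong p 1 (\<Sum>m=1..N. (harmonic 1 (2 * m) - harmonic 1 m) / of_nat m ^ 2) (- harmonic 3 N)"
proof -
  let ?X = "\<Sum>m=1..N. (harmonic 1 (2 * m) - harmonic 1 m) / of_nat m ^ 2 :: rat"
  let ?h = "harmonic 3 N / 4 :: rat"
  have "rat_cong p 1 (- 1 / 2 * ?X - ?h)
      (- (2 * (\<Sum>n=1..2 * N. (- 1) ^ n * (harmonic 1 (n - 1) / of_nat n ^ 2))))"
    using triangle_sum_reflect_cong
    by (simp only: inner_alternating_triangle_sum outer_alternating_triangle_sum)
  also have "rat_cong p 1 \<dots> (- (- ?h))"
    by (intro rat_cong_minus alternating_harmonic_sum_cong)
  finally have "rat_cong p 1 (- 1 / 2 * ?X - ?h) (- (- ?h))" .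
  then have "rat_cong p 1 (- 2 * ((- 1 / 2 * ?X - ?h) + ?h)) (- 2 * (- (- ?h) + ?h))"
    by (intro rat_cong_mult rat_cong_add rat_cong_refl p_integral_intros p_integral_harmonic) auto
  then show ?thesis by simp
qed

end

section \<open>Bernoulli numbers and half-range power sums\<close>

definition bernoulli_fps :: "rat fps" where
  "bernoulli_fps = Abs_fps (\<lambda>n. bernoulli n / fact n)"

lemma bernoulli_fps_nth: "fps_nth bernoulli_fps n = bernoulli n / fact n"
  by (simp add: bernoulli_fps_def)

lemma bernoulli_fps_mult: "bernoulli_fps * (fps_exp 1 - 1) = fps_X"
  using bernoulli_egf by (simp add: bernoulli_fps_def)

lemma bernoulli_fps_half:
  "bernoulli_fps * fps_exp (1 / 2) =
     fps_const 2 * (bernoulli_fps oo (fps_const (1 / 2) * fps_X)) - bernoulli_fps"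
proof -
  define e where "e = fps_exp (1 / 2 :: rat)"
  define h where "h = bernoulli_fps oo (fps_const (1 / 2) * fps_X)"
  have factor: "fps_exp 1 - 1 = (e - 1) * (e + 1)"
    using fps_exp_add_mult[of "1 / 2 :: rat" "1 / 2"] by (simp add: e_def algebra_simps)
  have "h * (e - 1) = (bernoulli_fps * (fps_exp 1 - 1)) oo (fps_const (1 / 2) * fps_X)"
    unfolding h_def e_def
    by (subst fps_compose_mult_distrib)
       (simp_all add: fps_compose_sub_distrib fps_exp_compose_linear)
  then have half_argument: "h * (e - 1) = fps_const (1 / 2) * fps_X"
    by (simp add: bernoulli_fps_mult)
  have "(bernoulli_fps * e) * (fps_exp 1 - 1) = (bernoulli_fps * (fps_exp 1 - 1)) * e"
    by (simp only: mult_ac)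
  also have "\<dots> = fps_X * (e + 1) - fps_X"
    unfolding bernoulli_fps_mult by (simp add: algebra_simps)
  also have "\<dots> = fps_const 2 * (h * (e - 1)) * (e + 1) - bernoulli_fps * (fps_exp 1 - 1)"
    unfolding half_argument bernoulli_fps_mult by (simp add: mult.assoc[symmetric])
  also have "\<dots> = (fps_const 2 * h - bernoulli_fps) * (fps_exp 1 - 1)"
    unfolding factor by (simp add: algebra_simps)
  finally show ?thesis
    using bernoulli_fps_mult by (auto simp: h_def e_def)
qed

lemma bernoulli_poly_half:
  "(\<Sum>i=0..n. bernoulli i / fact i * ((1 / 2) ^ (n - i) / fact (n - i))) =
     (2 / 2 ^ n - 1) * (bernoulli n / fact n)"
proof -
  have "fps_nth (bernoulli_fps * fps_exp (1 / 2)) n = (2 / 2 ^ n - 1) * (bernoulli n / fact n)"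
    unfolding bernoulli_fps_half
    by (simp add: bernoulli_fps_nth left_diff_distrib diff_divide_distrib power_one_over)
  then show ?thesis by (simp add: fps_mult_nth bernoulli_fps_nth)
qed

lemma faulhaber:
  "(\<Sum>k<M. of_nat k ^ n / fact n) =
    (\<Sum>i=0..Suc n. bernoulli i / fact i * (of_nat M ^ (Suc n - i) / fact (Suc n - i)))
      - bernoulli (Suc n) / fact (Suc n)"
proof -
  define E :: "rat fps" where "E = (\<Sum>k<M. fps_exp (of_nat k))"
  have geometric: "E * (fps_exp 1 - 1) = fps_exp (of_nat M) - 1"
    unfolding E_def by (induction M) (simp_all add: algebra_simps fps_exp_add_mult)
  have "E * fps_X = bernoulli_fps * (E * (fps_exp 1 - 1))"
    unfolding bernoulli_fps_mult[symmetric] by (simp only: mult_ac)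
  also have "\<dots> = bernoulli_fps * fps_exp (of_nat M) - bernoulli_fps"
    unfolding geometric by (simp add: algebra_simps)
  finally have "fps_nth (E * fps_X) (Suc n) =
      fps_nth (bernoulli_fps * fps_exp (of_nat M) - bernoulli_fps) (Suc n)"
    by (rule arg_cong)
  then show ?thesis
    by (simp add: E_def fps_mult_nth[of bernoulli_fps] fps_sum_nth bernoulli_fps_nth)
qed

lemma bernoulli_over_fact_rec:
  "bernoulli n / fact n =
     (if n = 0 then 1 else 0) - (\<Sum>i<n. bernoulli i / fact i / fact (Suc n - i))"
proof -
  have "fps_nth fps_X (Suc n) = fps_nth (bernoulli_fps * (fps_exp 1 - 1)) (Suc n)"
    by (simp only: bernoulli_fps_mult)
  also have "\<dots> = (\<Sum>i\<le>n. bernoulli i / fact i / fact (Suc n - i))"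
    unfolding fps_mult_nth sum.atLeast0_atMost_Suc
    by (auto simp: bernoulli_fps_nth atLeast0AtMost intro!: sum.cong)
  also have "\<dots> = (\<Sum>i<n. bernoulli i / fact i / fact (Suc n - i)) + bernoulli n / fact n"
    by (simp add: lessThan_Suc_atMost[symmetric])
  finally show ?thesis by auto
qed

context rat_prime
begin

lemma p_integral_bernoulli_over_fact: "n + 1 < p \<Longrightarrow> p_integral p (bernoulli n / fact n)"
proof (induction n rule: less_induct)
  case (less n)
  have "p_integral p (bernoulli i / fact i / fact (Suc n - i))" if "i < n" for i
    using less that by (intro p_integral_divide[of "bernoulli i / fact i"] p_unit_fact) auto
  then show ?case
    unfolding bernoulli_over_fact_rec[of n] by auto
qed

lemma p_integral_bernoulli:
  assumes "n + 1 < p"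
  shows "p_integral p (bernoulli n)"
proof -
  have "p_integral p (fact n * (bernoulli n / fact n))"
    using assms
    by (intro p_integral_mult p_integral_bernoulli_over_fact p_unit_integral p_unit_fact) auto
  then show ?thesis by simp
qed

end

context odd_rat_prime
begin

lemma half_power_sum_cong:
  assumes "n + 2 < p"
  shows "rat_cong p 1 (\<Sum>k\<le>N. of_nat k ^ n)
    ((1 / 2 ^ n - 2) * bernoulli (Suc n) / of_nat (Suc n))"
proof -
  let ?\<beta> = "\<lambda>i. bernoulli i / fact i"
  have Suc_N_cong_half: "rat_cong p 1 (of_nat (Suc N)) (1 / 2)"
    using P_eq by (intro rat_congI[of _ "1 / 2"]) auto
  have \<beta>_integral: "p_integral p (?\<beta> i)" if "i \<le> Suc n" for i
    using that assms by (intro p_integral_bernoulli_over_fact) auto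
  have "(\<Sum>k\<le>N. of_nat k ^ n) = fact n * (\<Sum>k<Suc N. of_nat k ^ n / fact n :: rat)"
    by (simp only: sum_divide_distrib[symmetric] lessThan_Suc_atMost) simp
  also have "\<dots> = fact n *
      ((\<Sum>i=0..Suc n. ?\<beta> i * (of_nat (Suc N) ^ (Suc n - i) / fact (Suc n - i))) - ?\<beta> (Suc n))"
    by (simp only: faulhaber)
  also have "rat_cong p 1 \<dots> (fact n *
      ((\<Sum>i=0..Suc n. ?\<beta> i * ((1 / 2) ^ (Suc n - i) / fact (Suc n - i))) - ?\<beta> (Suc n)))"
    using assms
    by (intro rat_cong_mult rat_cong_diff rat_cong_sum rat_cong_divide rat_cong_power
        Suc_N_cong_half rat_cong_refl \<beta>_integral p_unit_integral p_unit_fact) auto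
  also have "\<dots> = fact n * ((1 / 2 ^ n - 2) * ?\<beta> (Suc n))"
  proof -
    have "(2 / 2 ^ Suc n - 1) * x - x = (1 / 2 ^ n - 2) * x" for x :: rat
      by (simp add: algebra_simps)
    then show ?thesis by (simp only: bernoulli_poly_half)
  qed
  also have "\<dots> = (1 / 2 ^ n - 2) * bernoulli (Suc n) / of_nat (Suc n)"
    by (simp del: of_nat_Suc)
  finally show ?thesis .
qed

lemma power_cong_inverse_power:
  assumes "0 < k" "k < p" "r < p"
  shows "rat_cong p 1 (of_nat k ^ (p - 1 - r)) (1 / of_nat k ^ r)"
proof -
  have unit: "p_unit p (of_nat k)" using assms by (intro p_unit_of_nat)
  have "p - 1 = (p - 1 - r) + r" using assms by simp
  then have "(of_nat k :: rat) ^ (p - 1) = of_nat k ^ (p - 1 - r) * of_nat k ^ r"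
    by (metis power_add)
  then have "of_nat k ^ (p - 1 - r) = (of_nat k ^ (p - 1) / of_nat k ^ r :: rat)"
    using assms by simp
  also have "rat_cong p 1 \<dots> (1 / of_nat k ^ r)"
    using assms unit by (intro rat_cong_divide fermat_rat_cong rat_cong_refl) auto
  finally show ?thesis .
qed

lemma harmonic_half_cong:
  assumes "1 < r" "r < p - 1"
  shows "rat_cong p 1 (harmonic r N) ((2 - 2 ^ r) / of_nat r * bernoulli (p - r))"
proof -
  define n where "n = p - 1 - r"
  have Suc_n: "Suc n = p - r" and n_bounds: "n \<noteq> 0" "n + 2 < p"
    using assms by (auto simp: n_def)
  have inverse_power: "rat_cong p 1 (of_nat k ^ n) (1 / of_nat k ^ r)" if "0 < k" "k < p" for k
    unfolding n_def using that assms by (intro power_cong_inverse_power) auto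
  have "rat_cong p 1 (harmonic r N) (\<Sum>k=1..N. of_nat k ^ n)"
    unfolding harmonic_def
    using p_eq by (intro rat_cong_sum rat_cong_sym[OF inverse_power]) auto
  also have "(\<Sum>k=1..N. of_nat k ^ n) = (\<Sum>k\<le>N. of_nat k ^ n :: rat)"
    using n_bounds(1) by (intro sum.mono_neutral_left) auto
  also have "rat_cong p 1 \<dots> ((1 / 2 ^ n - 2) * bernoulli (p - r) / of_nat (p - r))"
    using half_power_sum_cong[OF n_bounds(2)] by (simp only: Suc_n)
  also have "rat_cong p 1 \<dots> ((2 ^ r - 2) * bernoulli (p - r) / (- of_nat r))"
  proof (intro rat_cong_divide rat_cong_mult rat_cong_diff rat_cong_refl p_integral_bernoulli)
    have "rat_cong p 1 (2 ^ n) (1 / 2 ^ r)"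
      using inverse_power[of 2] assms by simp
    then have "rat_cong p 1 (1 / 2 ^ n) (1 / (1 / 2 ^ r))"
      by (intro rat_cong_divide rat_cong_refl p_unit_inverse p_unit_power) auto
    then show "rat_cong p 1 (1 / 2 ^ n) (2 ^ r)" by simp
    show "rat_cong p 1 (of_nat (p - r)) (- of_nat r)"
      using assms by (intro rat_congI[of _ 1]) (auto simp: of_nat_diff)
    show "p_unit p (of_nat (p - r))" "p_unit p (- of_nat r)"
      using assms by (auto intro!: p_unit_minus p_unit_of_nat simp del: of_nat_diff)
  qed (use assms in auto)
  also have "(2 ^ r - 2) * bernoulli (p - r) / (- of_nat r) =
      (2 - 2 ^ r) / of_nat r * bernoulli (p - r)"
    by (simp add: algebra_simps diff_divide_distrib)
  finally show ?thesis .
qed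

end

section \<open>The supercongruence\<close>

lemma gbinomial_eq_prod:
  fixes a :: "'a::field_char_0"
  shows "a gchoose k = (- 1) ^ k * (\<Prod>i=1..k. 1 - (a + 1) / of_nat i)"
proof -
  have "a gchoose k = (- 1) ^ k * (\<Prod>i=0..<k. (of_nat k - a - 1 - of_nat i) / of_nat (k - i))"
    by (subst gbinomial_negated_upper) (simp only: gbinomial_altdef_of_nat)
  also have "(\<Prod>i=0..<k. (of_nat k - a - 1 - of_nat i) / of_nat (k - i)) =
      (\<Prod>i=1..k. 1 - (a + 1) / of_nat i)"
    by (rule prod.reindex_bij_witness[of _ "\<lambda>i. k - i" "\<lambda>i. k - i"])
       (auto simp: of_nat_diff field_simps)
  finally show ?thesis .
qed

context odd_rat_prime
begin

lemma prime_binomial_cong: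
  assumes "k \<in> {1..2 * N}"
  shows "rat_cong p 2 (of_nat (p choose k) / P)
    ((- 1) ^ (k - 1) / of_nat k * (1 + P * (- harmonic 1 (k - 1))))"
proof -
  have "p = Suc (2 * N)" "k = Suc (k - 1)" using assms p_eq by auto
  then have "of_nat k * of_nat (p choose k) = P * of_nat (2 * N choose (k - 1))"
    using Suc_times_binomial[of "k - 1" "2 * N"] by (metis of_nat_mult)
  then have "of_nat (p choose k) / P = of_nat (2 * N choose (k - 1)) / of_nat k"
    using assms by (simp add: divide_simps mult.commute)
  also have "\<dots> = (- 1) ^ (k - 1) / of_nat k * (\<Prod>i=1..k - 1. 1 + P ^ 1 * (- (1 / of_nat i)))"
    by (simp add: binomial_gbinomial gbinomial_eq_prod P_eq)
  also have "rat_cong p 2 \<dots>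
      ((- 1) ^ (k - 1) / of_nat k * (1 + P ^ 1 * (\<Sum>i=1..k - 1. - (1 / of_nat i))))"
    using assms
    by (intro rat_cong_mult rat_cong_refl prod_one_plus_cong[where s = 1] p_integral_intros
        p_unit_index) auto
  finally show ?thesis
    by (simp add: harmonic_def sum_negf)
qed

lemma p_unit_odd: "i < N \<Longrightarrow> p_unit p (2 * of_nat i + 1)"
  using p_unit_index[of "2 * i + 1"] by (simp add: add.commute)

lemma sine_ratio_prod_cong:
  assumes "m \<le> N"
  shows "rat_cong p 2 (\<Prod>i<m. (P + 4 * of_nat i + 2) / (4 * of_nat i + 2 - 3 * P))
    (1 + P * (2 * harmonic 1 (2 * m) - harmonic 1 m))"
proof -
  have denominator: "p_unit p (4 * of_nat i + 2 - 3 * P)" if "i < m" for i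
    using p_unit_diff_P_mult[OF p_unit_mult[OF p_unit_2 p_unit_odd], of i 3] that assms
    by (simp add: algebra_simps)
  have "(\<Prod>i<m. (P + 4 * of_nat i + 2) / (4 * of_nat i + 2 - 3 * P)) =
      (\<Prod>i<m. 1 + P ^ 1 * (4 / (4 * of_nat i + 2 - 3 * P)))"
    using denominator[THEN p_unit_nonzero] by (intro prod.cong refl) (auto simp: field_simps)
  moreover have "rat_cong p 2 \<dots> (1 + P ^ 1 * (\<Sum>i<m. 4 / (2 * (2 * of_nat i + 1))))"
  proof (intro prod_one_plus_cong[where s = 1] rat_cong_divide rat_cong_refl p_unit_mult)
    fix i assume "i \<in> {..<m}"
    then show "p_unit p (4 * of_nat i + 2 - 3 * P)" "p_unit p (2 * of_nat i + 1)"
      using denominator p_unit_odd assms by auto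
    then show "rat_cong p 1 (4 * of_nat i + 2 - 3 * P) (2 * (2 * of_nat i + 1))"
      by (intro rat_congI[of _ "- 3"] p_integral_mult) auto
  qed auto
  moreover have "4 / (2 * y) = 2 * (1 / y)" for y :: rat by simp
  then have "(\<Sum>i<m. 4 / (2 * (2 * of_nat i + 1))) = 2 * harmonic 1 (2 * m) - (harmonic 1 m :: rat)"
    by (simp only: sum_distrib_left[symmetric] sum_odd_reciprocals) simp
  ultimately show ?thesis by (simp only: power_one_right)
qed

lemma sine_ratio_cong:
  assumes "m \<in> {1..N}"
  shows "rat_cong p 2 (sine_ratio N m / P) (- (1 / (4 * of_nat m)) *
    (1 + P * (1 / (4 * of_nat m) + (2 * harmonic 1 (2 * m) - harmonic 1 m))))"
proof -
  define x :: rat where "x = 4 * of_nat m"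
  define v :: rat where "v = 2 * harmonic 1 (2 * m) - harmonic 1 m"
  define w :: rat where "w = (\<Prod>i<m. (P + 4 * of_nat i + 2) / (4 * of_nat i + 2 - 3 * P))"
  have x_unit: "p_unit p x"
    using assms unfolding x_def by (intro p_unit_mult p_unit_index) auto
  have v_integral: "p_integral p v"
    using assms unfolding v_def by (intro p_integral_intros p_integral_harmonic) auto
  have "rat_cong p 2 (x * (1 / (x - P))) (x * (1 / x + P / x\<^sup>2))"
    using x_unit inverse_diff_P_mult_cong[OF x_unit, of 1]
    by (intro rat_cong_mult rat_cong_refl) auto
  also have "x * (1 / x + P / x\<^sup>2) = 1 + P ^ 1 * (1 / x)"
    using x_unit by (simp add: distrib_left power2_eq_square)
  finally have "rat_cong p 2 (x * (1 / (x - P)) * w) (1 + P ^ 1 * (1 / x + v))"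
    using x_unit v_integral sine_ratio_prod_cong[of m] assms
    by (intro one_plus_mult_cong) (auto simp: w_def v_def)
  then have "rat_cong p 2 (- (1 / x) * (x * (1 / (x - P)) * w))
      (- (1 / x) * (1 + P ^ 1 * (1 / x + v)))"
    using x_unit by (intro rat_cong_mult rat_cong_refl p_integral_minus) auto
  moreover have "sine_ratio N m / P = w / (P - x)"
    by (simp add: sine_ratio_def P_eq[symmetric] x_def w_def)
  then have "sine_ratio N m / P = - (1 / x) * (x * (1 / (x - P)) * w)"
    using x_unit minus_divide_right[of w "x - P"] by simp
  ultimately show ?thesis by (simp add: x_def v_def)
qed

lemma sine_ratio_summand_cong:
  assumes "m \<in> {1..N}"
  shows "rat_cong p 4 (of_nat (p choose (2 * m)) * sine_ratio N m)
    (P\<^sup>2 * (1 / (8 * of_nat m ^ 2) *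
      (1 + P * (harmonic 1 (2 * m) - harmonic 1 m + 3 / (4 * of_nat m)))))"
proof -
  define x :: rat where "x = of_nat m"
  define u where "u = - (harmonic 1 (2 * m - 1) :: rat)"
  define v where "v = 1 / (4 * x) + (2 * harmonic 1 (2 * m) - harmonic 1 m)"
  have x_unit: "p_unit p x" using assms unfolding x_def by (intro p_unit_index) auto
  have uv_integral: "p_integral p u" "p_integral p v"
    using assms x_unit unfolding u_def v_def
    by (auto intro!: p_integral_intros p_integral_harmonic)
  have "rat_cong p 2 (of_nat (p choose (2 * m)) / P * (sine_ratio N m / P))
      (- 1 / (2 * x) * (1 + P * u) * (- (1 / (4 * x)) * (1 + P * v)))"
    using prime_binomial_cong[of "2 * m"] sine_ratio_cong[OF assms] assms
    by (intro rat_cong_mult) (auto simp: u_def v_def x_def)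
  also have "- 1 / (2 * x) * (1 + P * u) * (- (1 / (4 * x)) * (1 + P * v)) =
      1 / (8 * x\<^sup>2) * ((1 + P ^ 1 * u) * (1 + P ^ 1 * v))"
    by (simp add: power2_eq_square)
  also have "rat_cong p 2 \<dots> (1 / (8 * x\<^sup>2) * (1 + P ^ 1 * (u + v)))"
    using x_unit uv_integral
    by (intro rat_cong_mult rat_cong_refl one_plus_mult_cong p_integral_intros p_unit_mult
        p_unit_power) auto
  finally have "rat_cong p 4 (P\<^sup>2 * (of_nat (p choose (2 * m)) / P * (sine_ratio N m / P)))
      (P\<^sup>2 * (1 / (8 * x\<^sup>2) * (1 + P ^ 1 * (u + v))))"
    by (rule rat_cong_P_power_mult) simp
  moreover have "P\<^sup>2 * (of_nat (p choose (2 * m)) / P * (sine_ratio N m / P)) =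
      of_nat (p choose (2 * m)) * sine_ratio N m"
    by (simp add: power2_eq_square)
  moreover have "harmonic 1 (2 * m) = harmonic 1 (2 * m - 1) + 1 / (2 * x)"
    using harmonic_Suc[of 1 "2 * m - 1"] assms by (auto simp: x_def simp del: of_nat_Suc)
  then have "u + v = harmonic 1 (2 * m) - harmonic 1 m + 3 / (4 * x)"
    using x_unit by (simp add: u_def v_def field_simps)
  ultimately show ?thesis by (simp add: x_def)
qed

lemma sine_ratio_sum_cong:
  "rat_cong p 4 (\<Sum>m=1..N. of_nat (p choose (2 * m)) * sine_ratio N m)
    (P\<^sup>2 * (1 / 8 * (harmonic 2 N - 1 / 4 * P * harmonic 3 N)))"
proof -
  let ?H2 = "harmonic 2 N :: rat" and ?H3 = "harmonic 3 N :: rat"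
  let ?X = "\<Sum>m=1..N. (harmonic 1 (2 * m) - harmonic 1 m) / of_nat m ^ 2 :: rat"
  have "rat_cong p 4 (\<Sum>m=1..N. of_nat (p choose (2 * m)) * sine_ratio N m)
      (\<Sum>m=1..N. P\<^sup>2 * (1 / (8 * of_nat m ^ 2) *
        (1 + P * (harmonic 1 (2 * m) - harmonic 1 m + 3 / (4 * of_nat m)))))"
    by (intro rat_cong_sum sine_ratio_summand_cong)
  also have "\<dots> = (\<Sum>m=1..N. P\<^sup>2 * (1 / 8 * (1 / of_nat m ^ 2 +
      P * ((harmonic 1 (2 * m) - harmonic 1 m) / of_nat m ^ 2 + 3 / 4 * (1 / of_nat m ^ 3)))))"
  proof (rule sum.cong)
    fix m
    have "1 / (8 * y\<^sup>2) * (1 + P * (d + 3 / (4 * y))) =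
        1 / 8 * (1 / y\<^sup>2 + P * (d / y\<^sup>2 + 3 / 4 * (1 / y ^ 3)))" for y d :: rat
      by (simp add: algebra_simps add_divide_distrib power2_eq_square power3_eq_cube)
    then show "P\<^sup>2 * (1 / (8 * of_nat m ^ 2) *
          (1 + P * (harmonic 1 (2 * m) - harmonic 1 m + 3 / (4 * of_nat m)))) =
        P\<^sup>2 * (1 / 8 * (1 / of_nat m ^ 2 +
          P * ((harmonic 1 (2 * m) - harmonic 1 m) / of_nat m ^ 2 + 3 / 4 * (1 / of_nat m ^ 3))))"
      by (simp only:)
  qed simp
  also have "\<dots> = P\<^sup>2 * (1 / 8 * (?H2 + P ^ 1 * (?X + 3 / 4 * ?H3)))"
    by (simp only: harmonic_def[of 2] harmonic_def[of 3] sum.distrib sum_distrib_left[symmetric]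
        power_one_right)
  also have "rat_cong p 4 \<dots> (P\<^sup>2 * (1 / 8 * (?H2 + P ^ 1 * (- ?H3 + 3 / 4 * ?H3))))"
    by (intro rat_cong_P_power_mult[where s = 2] rat_cong_mult rat_cong_add
        rat_cong_P_power_mult[where s = 1] rat_cong_refl harmonic_difference_sum_cong
        p_integral_intros p_integral_harmonic) auto
  finally show ?thesis by (simp add: algebra_simps)
qed

lemma wz_sum_cong_harmonic:
  "rat_cong p 5 (\<Sum>k\<le>N. (6 * of_nat k + 1) * wz_term 0 k)
     (P * ((- 1) ^ N * (1 + P\<^sup>2 * (5 / 16 * harmonic 2 N + 7 / 32 * (P * harmonic 3 N)))))"
proof -
  let ?H2 = "harmonic 2 N :: rat" and ?H3 = "harmonic 3 N :: rat"
  define B where "B = (- 1) ^ N * (of_nat (2 * N choose N) / 16 ^ N :: rat)"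
  define S where "S = (\<Sum>m=1..N. of_nat (p choose (2 * m)) * sine_ratio N m :: rat)"
  have integral: "p_integral p ?H2" "p_integral p ?H3" by (simp_all add: p_integral_harmonic)
  have "rat_cong p 4 (1 + S) (1 + P\<^sup>2 * (1 / 8 * (?H2 - 1 / 4 * P * ?H3)))"
    unfolding S_def by (intro rat_cong_add rat_cong_refl sine_ratio_sum_cong) simp
  then have "rat_cong p 4 (B * (sine_prod N P * (1 + S)))
      (1 + P\<^sup>2 * ((?H2 + P * ?H3) / 4 + (- ?H2 / 16 + 1 / 8 * (?H2 - 1 / 4 * P * ?H3))))"
    unfolding B_def using integral
    by (intro one_plus_mult_cong central_binomial_cong sine_prod_cong p_integral_intros) auto
  also have "(?H2 + P * ?H3) / 4 + (- ?H2 / 16 + 1 / 8 * (?H2 - 1 / 4 * P * ?H3)) =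
      5 / 16 * ?H2 + 7 / 32 * (P * ?H3)"
    by (simp add: field_simps)
  finally have "rat_cong p 5 (P ^ 1 * ((- 1) ^ N * (B * (sine_prod N P * (1 + S)))))
      (P ^ 1 * ((- 1) ^ N * (1 + P\<^sup>2 * (5 / 16 * ?H2 + 7 / 32 * (P * ?H3)))))"
    by (intro rat_cong_P_power_mult[where s = 4] rat_cong_mult rat_cong_refl p_integral_power) auto
  moreover have "(\<Sum>k\<le>N. (6 * of_nat k + 1) * wz_term 0 k) =
      P ^ 1 * ((- 1) ^ N * (B * (sine_prod N P * (1 + S))))"
    unfolding wz_sum_factorization B_def S_def P_eq[symmetric] p_eq[symmetric]
    by (simp add: mult.assoc[symmetric] power_mult_distrib[symmetric])
  ultimately show ?thesis by simp
qed

lemma wz_sum_cong_bernoulli: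
  assumes "p > 3"
  shows "rat_cong p 5 (\<Sum>k\<le>N. (6 * of_nat k + 1) * wz_term 0 k)
    (P * (- 1) ^ N + (- 1) ^ N * (7 / 24) * P ^ 4 * bernoulli (p - 3))"
proof -
  let ?H2 = "harmonic 2 N :: rat" and ?H3 = "harmonic 3 N :: rat"
  have "p_unit p 3" using p_unit_of_nat[of 3] assms by simp
  then have unit_48: "p_unit p 48" by simp
  have "p \<noteq> 4" using p_eq by presburger
  then have harmonic_3_cong: "rat_cong p 1 ?H3 (- 2 * bernoulli (p - 3))"
    using harmonic_half_cong[of 3] assms by simp
  have "rat_cong p 2 (5 / 16 * ?H2 + 7 / 32 * (P * ?H3))
      (5 / 16 * (- 7 / 6 * P * ?H3) + 7 / 32 * (P * ?H3))"
    by (intro rat_cong_add rat_cong_mult[OF rat_cong_refl harmonic_2_half_cong] rat_cong_refl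
        p_integral_intros p_integral_harmonic assms) auto
  also have "5 / 16 * (- 7 / 6 * P * ?H3) + 7 / 32 * (P * ?H3) = P ^ 1 * (- 7 / 48 * ?H3)"
    by simp
  also have "rat_cong p 2 \<dots> (P ^ 1 * (- 7 / 48 * (- 2 * bernoulli (p - 3))))"
    using unit_48
    by (intro rat_cong_P_power_mult[where s = 1] rat_cong_mult harmonic_3_cong rat_cong_refl
        p_integral_divide) auto
  finally have "rat_cong p 2 (5 / 16 * ?H2 + 7 / 32 * (P * ?H3)) (P * (7 / 24 * bernoulli (p - 3)))"
    by simp
  then have "rat_cong p 5 (P ^ 1 * ((- 1) ^ N * (1 + P\<^sup>2 * (5 / 16 * ?H2 + 7 / 32 * (P * ?H3)))))
      (P ^ 1 * ((- 1) ^ N * (1 + P\<^sup>2 * (P * (7 / 24 * bernoulli (p - 3))))))"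
    by (intro rat_cong_P_power_mult[where s = 4] rat_cong_mult rat_cong_add
        rat_cong_P_power_mult[where s = 2] rat_cong_refl p_integral_power) auto
  with wz_sum_cong_harmonic have "rat_cong p 5 (\<Sum>k\<le>N. (6 * of_nat k + 1) * wz_term 0 k)
      (P ^ 1 * ((- 1) ^ N * (1 + P\<^sup>2 * (P * (7 / 24 * bernoulli (p - 3))))))"
    unfolding power_one_right by (rule rat_cong_trans)
  also have "P ^ 1 * ((- 1) ^ N * (1 + P\<^sup>2 * (P * (7 / 24 * bernoulli (p - 3))))) =
      P * (- 1) ^ N + (- 1) ^ N * (7 / 24) * P ^ 4 * bernoulli (p - 3)"
    by (simp add: algebra_simps eval_nat_numeral)
  finally show ?thesis .
qed

end

theorem theorem1p1:
  fixes p :: nat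
  assumes "prime p" and "p > 3"
  shows "rat_cong p 5
    (\<Sum>n = 0..(p - 1) div 2. of_nat (6 * n + 1) / 256 ^ n * of_nat ((2 * n) choose n) ^ 3)
    (of_nat p * (- 1) ^ ((p - 1) div 2)
      + (- 1) ^ ((p - 1) div 2) * (7 / 24) * of_nat p ^ 4 * bernoulli (p - 3))"
proof -
  have "odd p" using assms prime_odd_nat by auto
  then interpret odd_rat_prime p "(p - 1) div 2"
    using assms by unfold_locales auto
  have "(\<Sum>n = 0..(p - 1) div 2. of_nat (6 * n + 1) / 256 ^ n * of_nat ((2 * n) choose n) ^ 3) =
      (\<Sum>k\<le>(p - 1) div 2. (6 * of_nat k + 1) * wz_term (0 :: rat) k)"
    by (simp add: wz_term_at_0 atLeast0AtMost add.commute)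
  then show ?thesis
    using wz_sum_cong_bernoulli assms by simp
qed

end
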